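(* Consider an instance of the deadline scheduling problem described in the context, for which there exists an assignment $\mathcal{S}'$ as described there. Then there is a polynomial-time algorithm that computes a set $A_{\mathrm{discarded}}$ of tasks and a schedule $\mathcal{S}$ of the remaining tasks $A(J)\setminus A_{\mathrm{discarded}}$ such that: (1) every task is assigned to a (machine, slot) pair $(i,t)$ with $\mathsf{cap}_i(t)=1$, no two tasks are assigned to the same pair, and for every job all its non-discarded tasks are on a single machine; (2) for any two non-discarded tasks $a\prec a'$, the slot of $a$ is strictly smaller than the slot of $a'$; (3) the communication delay constraints hold: for every pair of jobs $j\prec j'$ such that the last task $a_{p_j,j}$ of $j$ and the first task $a_{1,j'}$ of $j'$ are both non-discarded and are on different machines, the slot of $a_{1,j'}$ is strictly greater than the slot of $a_{p_j,j}$ plus $1$; (4) $|A_{\mathrm{discarded}}| \le 6p^2 m\,\Delta(J)$.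
   Context: Deadline scheduling problem with precedence constraints and unit communication delays: there are $m$ machines and time slots $[T]=\{1,\dots,T\}$, partitioned into $p$ consecutive intervals $I_1,\dots,I_p$ of equal length. There is a set $J$ of jobs; job $j$ has a positive integer length $p_j$ and consists of $p_j$ unit tasks $a_{1,j} \prec a_{2,j}\prec\dots\prec a_{p_j,j}$; $A(j)$ denotes its set of tasks and $A(J)=\bigcup_j A(j)$. Each job has a release time $r_j$ and deadline $d_j$ (a window $[r_j,d_j]$ of slots), where each $r_j$ is the first slot of some interval $I_q$ and each $d_j$ is the last slot of some interval $I_{q'}$. The jobs carry a partial order $\prec$ with the property that $j\prec j'$ implies $r_j\le r_{j'}$ and $d_j\le d_{j'}$; for $j\prec j'$ every task of $j$ precedes every task of $j'$. $\Delta(J)$ denotes the maximum, over all chains (totally ordered subsets) $C\subseteq J$, of $\sum_{j\in C}p_j$. For each machine $i$ a capacity function $\mathsf{cap}_i:[T]\to\{0,1\}$ is given; slot $t$ on machine $i$ is available iff $\mathsf{cap}_i(t)=1$. It is assumed that there exists an assignment $\mathcal{S}':A(J)\to[m]\times[T]$ mapping tasks injectively to available (machine, slot) pairs such that every task of each job $j$ is placed in a slot in $[r_j,d_j]$ ($\mathcal{S}'$ need not respect precedence, communication delays or no-migration). *)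

theory Defs
  imports Main "HOL-Computational_Algebra.Polynomial" "HOL-Library.Log_Nat"
begin

section \<open>Instances\<close>

text \<open>
  Machines are \<open>1,\<dots>,m\<close>, slots \<open>1,\<dots>,T\<close> with \<open>T = p * L\<close>, where \<open>p\<close> is the number of intervals
  and \<open>L\<close> their common length. Jobs are numbered \<open>1,\<dots>,n\<close> (an arbitrary numbering, so that an
  instance can be the input of a machine); the task \<open>a\<^bsub>k,j\<^esub>\<close> is the pair \<open>(j, k)\<close>.
  The functional fields are only meaningful on jobs, machines and slots of the instance.
\<close>

record sched_instance =
  num_machines  :: nat
  num_intervals :: nat
  interval_len  :: nat
  num_jobs      :: nat
  job_len       :: "nat \<Rightarrow> nat"
  release       :: "nat \<Rightarrow> nat"
  deadline      :: "nat \<Rightarrow> nat"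
  job_prec      :: "nat \<Rightarrow> nat \<Rightarrow> bool"
  capacity      :: "nat \<Rightarrow> nat \<Rightarrow> nat"

definition horizon :: "sched_instance \<Rightarrow> nat" where
  "horizon I = num_intervals I * interval_len I"

definition interval :: "sched_instance \<Rightarrow> nat \<Rightarrow> nat set" where
  "interval I q = {(q - 1) * interval_len I + 1 .. q * interval_len I}"

definition jobs :: "sched_instance \<Rightarrow> nat set" where
  "jobs I = {1..num_jobs I}"

definition tasks_of :: "sched_instance \<Rightarrow> nat \<Rightarrow> (nat \<times> nat) set" where
  "tasks_of I j = {(j, k) | k. k \<in> {1..job_len I j}}"

definition tasks :: "sched_instance \<Rightarrow> (nat \<times> nat) set" where
  "tasks I = (\<Union>j\<in>jobs I. tasks_of I j)"

definition task_prec :: "sched_instance \<Rightarrow> nat \<times> nat \<Rightarrow> nat \<times> nat \<Rightarrow> bool" where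
  "task_prec I a a' \<longleftrightarrow>
     (fst a = fst a' \<and> snd a < snd a') \<or> job_prec I (fst a) (fst a')"

definition is_chain :: "sched_instance \<Rightarrow> nat set \<Rightarrow> bool" where
  "is_chain I C \<longleftrightarrow> C \<subseteq> jobs I \<and>
     (\<forall>j\<in>C. \<forall>j'\<in>C. j = j' \<or> job_prec I j j' \<or> job_prec I j' j)"

definition Delta :: "sched_instance \<Rightarrow> nat" where
  "Delta I = Max {(\<Sum>j\<in>C. job_len I j) | C. is_chain I C}"

definition available :: "sched_instance \<Rightarrow> (nat \<times> nat) set" where
  "available I =
     {(i, t). i \<in> {1..num_machines I} \<and> t \<in> {1..horizon I} \<and> capacity I i t = 1}"

definition valid_instance :: "sched_instance \<Rightarrow> bool" where
  "valid_instance I \<longleftrightarrow>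
     interval_len I \<ge> 1 \<and>
     (\<forall>j\<in>jobs I. job_len I j \<ge> 1) \<and>
     (\<forall>j\<in>jobs I. \<exists>q\<in>{1..num_intervals I}. release I j = Min (interval I q)) \<and>
     (\<forall>j\<in>jobs I. \<exists>q\<in>{1..num_intervals I}. deadline I j = Max (interval I q)) \<and>
     irreflp_on (jobs I) (job_prec I) \<and>
     transp_on (jobs I) (job_prec I) \<and>
     (\<forall>j\<in>jobs I. \<forall>j'\<in>jobs I. job_prec I j j' \<longrightarrow>
        release I j \<le> release I j' \<and> deadline I j \<le> deadline I j') \<and>
     (\<forall>i\<in>{1..num_machines I}. \<forall>t\<in>{1..horizon I}. capacity I i t \<in> {0, 1})"

definition relaxed_assignment ::
  "sched_instance \<Rightarrow> (nat \<times> nat \<Rightarrow> nat \<times> nat) \<Rightarrow> bool" where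
  "relaxed_assignment I S' \<longleftrightarrow>
     inj_on S' (tasks I) \<and>
     S' ` tasks I \<subseteq> available I \<and>
     (\<forall>j\<in>jobs I. \<forall>a\<in>tasks_of I j. snd (S' a) \<in> {release I j..deadline I j})"

section \<open>Machine model\<close>

text \<open>
  A random access machine with finitely many arrays of natural numbers, presented as a structured
  language; a scalar variable is cell 0 of an array. Every operation has unit cost. The only
  arithmetic operations are addition and truncated subtraction, so after \<open>t\<close> steps every value has
  at most \<open>t\<close> bits more than the longest number in the input or the program, and polynomial time in
  this model agrees with polynomial time on Turing machines.
\<close>

type_synonym store = "nat \<Rightarrow> nat \<Rightarrow> nat"

datatype aexp =
    Const nat
  | Cell nat aexp
  | Add aexp aexp
  | Sub aexp aexp

datatype bexp =
    Less aexp aexp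
  | Equal aexp aexp
  | Neg bexp
  | Conj bexp bexp

datatype com =
    Skip
  | Assign nat aexp aexp
  | Seq com com
  | Cond bexp com com
  | While bexp com

primrec aval :: "aexp \<Rightarrow> store \<Rightarrow> nat" where
  "aval (Const n) s = n"
| "aval (Cell x e) s = s x (aval e s)"
| "aval (Add e f) s = aval e s + aval f s"
| "aval (Sub e f) s = aval e s - aval f s"

primrec acost :: "aexp \<Rightarrow> nat" where
  "acost (Const n) = 1"
| "acost (Cell x e) = acost e + 1"
| "acost (Add e f) = acost e + acost f + 1"
| "acost (Sub e f) = acost e + acost f + 1"

primrec bval :: "bexp \<Rightarrow> store \<Rightarrow> bool" where
  "bval (Less e f) s \<longleftrightarrow> aval e s < aval f s"
| "bval (Equal e f) s \<longleftrightarrow> aval e s = aval f s"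
| "bval (Neg b) s \<longleftrightarrow> \<not> bval b s"
| "bval (Conj b c) s \<longleftrightarrow> bval b s \<and> bval c s"

primrec bcost :: "bexp \<Rightarrow> nat" where
  "bcost (Less e f) = acost e + acost f + 1"
| "bcost (Equal e f) = acost e + acost f + 1"
| "bcost (Neg b) = bcost b + 1"
| "bcost (Conj b c) = bcost b + bcost c + 1"

text \<open>\<open>exec c s t s'\<close>: started in \<open>s\<close>, the program \<open>c\<close> halts in \<open>s'\<close> after exactly \<open>t\<close> steps.\<close>

inductive exec :: "com \<Rightarrow> store \<Rightarrow> nat \<Rightarrow> store \<Rightarrow> bool" where
  Skip: "exec Skip s 1 s"
| Assign: "exec (Assign x e f) s (acost e + acost f + 1)
             (s(x := (s x)(aval e s := aval f s)))"
| Seq: "exec c s t s' \<Longrightarrow> exec d s' u s'' \<Longrightarrow> exec (Seq c d) s (t + u) s''"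
| CondTrue: "bval b s \<Longrightarrow> exec c s t s' \<Longrightarrow> exec (Cond b c d) s (bcost b + t) s'"
| CondFalse: "\<not> bval b s \<Longrightarrow> exec d s t s' \<Longrightarrow> exec (Cond b c d) s (bcost b + t) s'"
| WhileFalse: "\<not> bval b s \<Longrightarrow> exec (While b c) s (bcost b) s"
| WhileTrue: "bval b s \<Longrightarrow> exec c s t s' \<Longrightarrow> exec (While b c) s' u s'' \<Longrightarrow>
    exec (While b c) s (bcost b + t + u) s''"

inductive_cases SkipE: "exec Skip s t s'"
inductive_cases AssignE: "exec (Assign x e f) s t s'"
inductive_cases SeqE: "exec (Seq c d) s t s'"
inductive_cases CondE: "exec (Cond b c d) s t s'"
inductive_cases WhileE: "exec (While b c) s t s'"

lemma exec_deterministic: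
  "exec c s t s' \<Longrightarrow> exec c s u s'' \<Longrightarrow> u = t \<and> s'' = s'"
proof (induction arbitrary: u s'' rule: exec.induct)
  case Skip
  then show ?case by (auto elim: SkipE)
next
  case Assign
  then show ?case by (auto elim: AssignE)
next
  case Seq
  from Seq.prems show ?case by (rule SeqE) (use Seq.IH in blast)
next
  case CondTrue
  from CondTrue.prems show ?case by (rule CondE) (use CondTrue.IH CondTrue.hyps in blast)+
next
  case CondFalse
  from CondFalse.prems show ?case by (rule CondE) (use CondFalse.IH CondFalse.hyps in blast)+
next
  case WhileFalse
  from WhileFalse.prems show ?case by (rule WhileE) (use WhileFalse.hyps in auto)
next
  case WhileTrue
  from WhileTrue.prems show ?case by (rule WhileE) (use WhileTrue.IH WhileTrue.hyps in blast)+
qed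

text \<open>The input is placed in array 0, the output is read from array 1.\<close>

definition init_store :: "nat list \<Rightarrow> store" where
  "init_store xs = (\<lambda>x i. if x = 0 \<and> i < length xs then xs ! i else 0)"

definition has_output :: "store \<Rightarrow> nat list \<Rightarrow> bool" where
  "has_output s ys \<longleftrightarrow> (\<forall>i<length ys. s 1 i = ys ! i)"

text \<open>Numbers are measured in binary, with one delimiter symbol each.\<close>

definition input_size :: "nat list \<Rightarrow> nat" where
  "input_size xs = (\<Sum>x\<leftarrow>xs. floorlog 2 x + 1)"

section \<open>Encoding of instances and schedules\<close>

definition encode_instance :: "sched_instance \<Rightarrow> nat list" where
  "encode_instance I =
     [num_machines I, num_intervals I, interval_len I, num_jobs I] @
     concat (map (\<lambda>j. [job_len I j, release I j, deadline I j]) [1..<num_jobs I + 1]) @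
     [of_bool (job_prec I j j'). j \<leftarrow> [1..<num_jobs I + 1], j' \<leftarrow> [1..<num_jobs I + 1]] @
     [capacity I i t. i \<leftarrow> [1..<num_machines I + 1], t \<leftarrow> [1..<horizon I + 1]]"

definition task_list :: "sched_instance \<Rightarrow> (nat \<times> nat) list" where
  "task_list I = [(j, k). j \<leftarrow> [1..<num_jobs I + 1], k \<leftarrow> [1..<job_len I j + 1]]"

text \<open>
  Two numbers per task: its machine and slot, or \<open>0, 0\<close> if it is discarded. As machines and slots
  are numbered from 1, the output determines the discarded set and the schedule of the other tasks.
\<close>

definition encode_schedule ::
  "sched_instance \<Rightarrow> (nat \<times> nat) set \<Rightarrow> (nat \<times> nat \<Rightarrow> nat \<times> nat) \<Rightarrow> nat list" where
  "encode_schedule I D S =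
     concat (map (\<lambda>a. if a \<in> D then [0, 0] else [fst (S a), snd (S a)]) (task_list I))"

end

theory Submission imports Defs begin

text \<open>
  A single greedy sweep over the slots suffices. Each job carries \<open>p\<^sub>j + 1\<close> units of work: its tasks and one final unit that
  models the communication delay. In each slot every vacant machine with capacity takes an unstarted
  job all of whose predecessors have no work left, and every occupied machine with capacity
  schedules the next task of its job. If some machine with capacity stays vacant, the occupied
  machines without capacity discard the next task of their job. In such an idle slot every minimal
  unfinished job loses a unit of work, so the heaviest chain of remaining work, initially at most
  \<open>2 \<Delta>\<close>, shrinks: there are at most \<open>2 \<Delta>\<close> idle slots before all work is done, and each of them
  discards at most \<open>m\<close> tasks and leaves at most \<open>m\<close> available pairs unused. If all work gets done, only
  tasks discarded in idle slots are lost. Otherwise every unused available pair lies in an idle slot,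
  and since the tasks fit into the available pairs, at most as many tasks are lost as pairs are
  unused. Hence at most \<open>2 m \<Delta>\<close> tasks are discarded.
\<close>

section \<open>The greedy sweep\<close>

text \<open>The delay is handled without comparing machines: a job whose last task is over leaves
  its machine but keeps one unit of work through the next slot, so placed tasks of related jobs are
  always separated by a full slot. Discarding in idle slots is forced by charging: an occupied
  machine without capacity could otherwise hold up a chain while vacant capacity passes by, and that
  capacity could not be charged to anything. A discard pays for it with a unit of chain weight.
  Which ready job a vacant machine takes does not matter. A slot is therefore a relation between
  states, the counting covers every run of this relation, and the program only has to produce one
  such run. The running time needs \<open>T\<close> to be polynomial in the input size although
  \<open>p\<close> and \<open>L\<close> are written in binary. The input lists \<open>m * T\<close>
  capacities, and a single job forces \<open>m \<ge> 1\<close> through the assumed assignment. A job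
  also forces \<open>p \<ge> 1\<close>, which turns the factor 2 into the claimed
  \<open>6 * p^2\<close>.\<close>

text \<open>
  \<open>rem j\<close> is the remaining work of job \<open>j\<close> including the delay unit, \<open>mac j\<close> its machine (0 if not
  started), \<open>own i\<close> the job occupying machine \<open>i\<close> (0 if vacant), and \<open>out\<close> the schedule built so
  far, with \<open>(0, 0)\<close> for tasks that are not placed. The next task of \<open>j\<close> has index
  \<open>p\<^sub>j + 2 - rem j\<close>.
\<close>

record state =
  rem :: "nat \<Rightarrow> nat"
  mac :: "nat \<Rightarrow> nat"
  own :: "nat \<Rightarrow> nat"
  out :: "nat \<times> nat \<Rightarrow> nat \<times> nat"

definition machines :: "sched_instance \<Rightarrow> nat set" where
  "machines I = {1..num_machines I}"

text \<open>The value 0, rather than 1, makes a successor wait until the delay unit has expired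
  too.\<close>

definition ready :: "sched_instance \<Rightarrow> (nat \<Rightarrow> nat) \<Rightarrow> nat \<Rightarrow> bool" where
  "ready I r j \<longleftrightarrow> (\<forall>j'\<in>jobs I. job_prec I j' j \<longrightarrow> r j' = 0)"

text \<open>
  Machines \<open>1, \<dots>, k\<close> have been offered unstarted ready jobs; this changed the occupancy from \<open>w\<close> to
  \<open>w'\<close> and the machine assignment from \<open>c\<close> to \<open>c'\<close>, and \<open>idle\<close> tells whether one of these machines
  with capacity in slot \<open>t\<close> remained vacant.
\<close>

definition starts :: "sched_instance \<Rightarrow> nat \<Rightarrow> nat \<Rightarrow> bool \<Rightarrow> (nat \<Rightarrow> nat) \<Rightarrow> (nat \<Rightarrow> nat) \<Rightarrow> (nat \<Rightarrow> nat)
    \<Rightarrow> (nat \<Rightarrow> nat) \<Rightarrow> (nat \<Rightarrow> nat) \<Rightarrow> bool" where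
  "starts I t k idle r w c w' c' \<longleftrightarrow>
     (\<forall>i\<in>machines I. w i \<noteq> 0 \<longrightarrow> w' i = w i) \<and>
     (\<forall>j\<in>jobs I. c j \<noteq> 0 \<longrightarrow> c' j = c j) \<and>
     (\<forall>i\<in>machines I. w i = 0 \<and> w' i \<noteq> 0 \<longrightarrow>
        w' i \<in> jobs I \<and> c (w' i) = 0 \<and> ready I r (w' i) \<and> c' (w' i) = i) \<and>
     (\<forall>j\<in>jobs I. c j = 0 \<and> c' j \<noteq> 0 \<longrightarrow> c' j \<in> machines I \<and> w (c' j) = 0 \<and> w' (c' j) = j) \<and>
     (idle \<longleftrightarrow> (\<exists>i\<in>{1..k}. w' i = 0 \<and> capacity I i t = 1)) \<and>
     (idle \<longrightarrow> (\<forall>j\<in>jobs I. ready I r j \<longrightarrow> c' j \<noteq> 0))"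

text \<open>\<open>c j\<close> is never reset once \<open>j\<close> has started, because all placed
  tasks of \<open>j\<close> stay tied to that machine. The test \<open>w (c j) = j\<close> tells
  whether \<open>j\<close> still occupies it.\<close>

definition advancing ::
  "sched_instance \<Rightarrow> nat \<Rightarrow> bool \<Rightarrow> (nat \<Rightarrow> nat) \<Rightarrow> (nat \<Rightarrow> nat) \<Rightarrow> nat \<Rightarrow> bool" where
  "advancing I t idle w c j \<longleftrightarrow>
     c j \<in> machines I \<and> w (c j) = j \<and> (capacity I (c j) t = 1 \<or> idle)"

text \<open>A job with work 1 has only its delay unit left, which expires in any slot; a machine is
  vacated on the step from 2 to 1. For a vacant machine, \<open>w i = 0\<close>, the test reads the
  meaningless \<open>rem st 0\<close>, but both branches give 0. Advancing without capacity writes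
  nothing and is thus a discard.\<close>

definition slot :: "sched_instance \<Rightarrow> nat \<Rightarrow> bool \<Rightarrow> state \<Rightarrow> state \<Rightarrow> bool" where
  "slot I t idle st st' \<longleftrightarrow> (\<exists>w.
     starts I t (num_machines I) idle (rem st) (own st) (mac st) w (mac st') \<and>
     (\<forall>j\<in>jobs I. rem st' j = (if advancing I t idle w (mac st') j then rem st j - 1
        else if rem st j = 1 then 0 else rem st j)) \<and>
     (\<forall>i\<in>machines I. own st' i =
        (if (capacity I i t = 1 \<or> idle) \<and> rem st (w i) = 2 then 0 else w i)) \<and>
     (\<forall>j\<in>jobs I. \<forall>k\<in>{1..job_len I j}. out st' (j, k) =
        (if advancing I t idle w (mac st') j \<and> capacity I (mac st' j) t = 1 \<and>
           k + rem st j = job_len I j + 2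
         then (mac st' j, t) else out st (j, k))))"

section \<open>Invariants of the sweep and their preservation\<close>

definition linked :: "sched_instance \<Rightarrow> (nat \<Rightarrow> nat) \<Rightarrow> (nat \<Rightarrow> nat) \<Rightarrow> (nat \<Rightarrow> nat) \<Rightarrow> bool" where
  "linked I r w c \<longleftrightarrow>
     (\<forall>j\<in>jobs I. r j \<le> job_len I j + 1 \<and> (c j = 0 \<longrightarrow> r j = job_len I j + 1)) \<and>
     (\<forall>i\<in>machines I. w i \<noteq> 0 \<longrightarrow> w i \<in> jobs I \<and> c (w i) = i \<and> 2 \<le> r (w i)) \<and>
     (\<forall>j\<in>jobs I. c j \<noteq> 0 \<and> 2 \<le> r j \<longrightarrow> c j \<in> machines I \<and> w (c j) = j) \<and>
     (\<forall>j\<in>jobs I. \<forall>j'\<in>jobs I. job_prec I j j' \<and> c j' \<noteq> 0 \<longrightarrow> r j = 0)"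

text \<open>Here \<open>t\<close> is the slot about to be processed, and the first clause keeps the
  entries from the next task on empty. The bound for \<open>r j = 0\<close> is the delay constraint
  stated in advance: a successor that is released by \<open>r j = 0\<close> is placed in slot
  \<open>t\<close> at the earliest.\<close>

definition recorded :: "sched_instance \<Rightarrow> nat \<Rightarrow> (nat \<Rightarrow> nat) \<Rightarrow> (nat \<Rightarrow> nat) \<Rightarrow>
    (nat \<times> nat \<Rightarrow> nat \<times> nat) \<Rightarrow> bool" where
  "recorded I t r c S \<longleftrightarrow>
     (\<forall>j\<in>jobs I. \<forall>k\<in>{1..job_len I j}. job_len I j + 2 \<le> k + r j \<longrightarrow> S (j, k) = (0, 0)) \<and>
     (\<forall>j\<in>jobs I. \<forall>k\<in>{1..job_len I j}. S (j, k) \<noteq> (0, 0) \<longrightarrow>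
        S (j, k) \<in> available I \<and> fst (S (j, k)) = c j \<and> snd (S (j, k)) < t \<and>
        (r j = 0 \<longrightarrow> snd (S (j, k)) + 1 < t))"

text \<open>Demanding the gap for all related jobs, whatever their machines, spares the invariant
  any comparison of machines.\<close>

definition feasible :: "sched_instance \<Rightarrow> (nat \<times> nat \<Rightarrow> nat \<times> nat) \<Rightarrow> bool" where
  "feasible I S \<longleftrightarrow>
     (\<forall>j\<in>jobs I. \<forall>k\<in>{1..job_len I j}. \<forall>j'\<in>jobs I. \<forall>k'\<in>{1..job_len I j'}.
        S (j, k) \<noteq> (0, 0) \<longrightarrow> S (j', k') \<noteq> (0, 0) \<longrightarrow>
        (S (j, k) = S (j', k') \<longrightarrow> j = j' \<and> k = k') \<and>
        (j = j' \<longrightarrow> k < k' \<longrightarrow> snd (S (j, k)) < snd (S (j', k'))) \<and>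
        (job_prec I j j' \<longrightarrow> snd (S (j, k)) + 1 < snd (S (j', k'))))"

definition consistent :: "sched_instance \<Rightarrow> nat \<Rightarrow> state \<Rightarrow> bool" where
  "consistent I t st \<longleftrightarrow> linked I (rem st) (own st) (mac st) \<and>
     recorded I t (rem st) (mac st) (out st) \<and> feasible I (out st)"

text \<open>A newly started job still has all its work, which is at least 2 since lengths are
  positive, and its readiness is exactly the last clause of \<open>linked\<close>. Earlier
  occupancies do not change.\<close>

lemma starts_linked:
  assumes "valid_instance I" and l: "linked I r w c" and s: "starts I t k idle r w c w' c'"
  shows "linked I r w' c'"
proof -
  have len: "job_len I j \<ge> 1" "j \<noteq> 0" if "j \<in> jobs I" for j
    using assms(1) that unfolding valid_instance_def jobs_def by auto
  have M: "i \<noteq> 0" if "i \<in> machines I" for i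
    using that unfolding machines_def by auto
  note l' = l[unfolded linked_def] and s' = s[unfolded starts_def]
  have m1: "w' i \<in> jobs I \<and> c' (w' i) = i \<and> 2 \<le> r (w' i)"
    if i: "i \<in> machines I" "w' i \<noteq> 0" for i
  proof (cases "w i = 0")
    case True
    then have "w' i \<in> jobs I \<and> c (w' i) = 0 \<and> c' (w' i) = i" using s' i by blast
    moreover from this have "r (w' i) = job_len I (w' i) + 1" using l' by blast
    ultimately show ?thesis using len[of "w' i"] by simp
  next
    case False
    then have "w' i = w i" "w i \<in> jobs I" "c (w i) = i" "2 \<le> r (w i)" using s' l' i by blast+
    moreover have "c' (w i) = c (w i)" using s' calculation M[OF i(1)] by metis
    ultimately show ?thesis by simp
  qed
  have m2: "c' j \<in> machines I \<and> w' (c' j) = j" if "j \<in> jobs I" "c' j \<noteq> 0" "2 \<le> r j" for j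
    using l' s' that len(2)[of j] by metis
  have m3: "r j = 0" if "j \<in> jobs I" "j' \<in> jobs I" "job_prec I j j'" "c' j' \<noteq> 0" for j j'
  proof (cases "c j' = 0")
    case True
    then have "c' j' \<in> machines I" "w (c' j') = 0" "w' (c' j') = j'" using s' that by blast+
    then have "ready I r j'" using s' len(2)[OF that(2)] by metis
    then show ?thesis using that unfolding ready_def by blast
  next
    case False
    then show ?thesis using l' that by blast
  qed
  have m4: "r j = job_len I j + 1" if "j \<in> jobs I" "c' j = 0" for j
    using l' s' that by metis
  have m5: "r j \<le> job_len I j + 1" if "j \<in> jobs I" for j
    using l' that by blast
  show ?thesis unfolding linked_def using m1 m2 m3 m4 m5 by (intro conjI ballI impI) blast+
qed

text \<open>A machine is vacated exactly when its job drops from 2 to 1, which preserves the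
  threshold 2 separating jobs with tasks left from those with at most the delay unit.\<close>

lemma slot_linked:
  assumes v: "valid_instance I" and l: "linked I (rem st) (own st) (mac st)"
    and s: "slot I t idle st st'"
  shows "linked I (rem st') (own st') (mac st')"
proof -
  obtain w where st: "starts I t (num_machines I) idle (rem st) (own st) (mac st) w (mac st')"
    and r: "\<And>j. j \<in> jobs I \<Longrightarrow> rem st' j = (if advancing I t idle w (mac st') j then rem st j - 1
        else if rem st j = 1 then 0 else rem st j)"
    and o: "\<And>i. i \<in> machines I \<Longrightarrow> own st' i =
        (if (capacity I i t = 1 \<or> idle) \<and> rem st (w i) = 2 then 0 else w i)"
    using s unfolding slot_def by blast
  have len: "job_len I j \<ge> 1" "j \<noteq> 0" if "j \<in> jobs I" for j
    using v that unfolding valid_instance_def jobs_def by auto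
  have M: "i \<noteq> 0" if "i \<in> machines I" for i
    using that unfolding machines_def by auto
  note l' = starts_linked[OF v l st, unfolded linked_def]
  have "rem st' j \<le> job_len I j + 1" if "j \<in> jobs I" for j
    using l' r[OF that] that by fastforce
  moreover have "rem st' j = job_len I j + 1" if "j \<in> jobs I" "mac st' j = 0" for j
  proof -
    have "\<not> advancing I t idle w (mac st') j" using that M unfolding advancing_def by auto
    then show ?thesis using l' r[OF that(1)] that len[OF that(1)] by auto
  qed
  moreover have "own st' i \<in> jobs I \<and> mac st' (own st' i) = i \<and> 2 \<le> rem st' (own st' i)"
    if i: "i \<in> machines I" "own st' i \<noteq> 0" for i
  proof -
    have w: "own st' i = w i" "\<not> ((capacity I i t = 1 \<or> idle) \<and> rem st (w i) = 2)"
      using o[OF i(1)] i(2) by (auto split: if_splits)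
    then have "w i \<in> jobs I \<and> mac st' (w i) = i \<and> 2 \<le> rem st (w i)" using l' i by metis
    \<comment> \<open>An occupant that advances without leaving its machine had work at least
      3.\<close>
    moreover from this have "2 \<le> rem st' (w i)"
      using w r[of "w i"] unfolding advancing_def by auto
    ultimately show ?thesis using w by simp
  qed
  moreover have "mac st' j \<in> machines I \<and> own st' (mac st' j) = j"
    if j: "j \<in> jobs I" "mac st' j \<noteq> 0" "2 \<le> rem st' j" for j
  proof -
    have "2 \<le> rem st j" using r[OF j(1)] j(3) by (auto split: if_splits)
    then have m: "mac st' j \<in> machines I" "w (mac st' j) = j" using l' j by blast+
    then show ?thesis using o[OF m(1)] r[OF j(1)] j(3)
      unfolding advancing_def by (auto split: if_splits)
  qed
  moreover have "rem st' j = 0"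
    if "j \<in> jobs I" "j' \<in> jobs I" "job_prec I j j'" "mac st' j' \<noteq> 0" for j j'
  proof -
    have "rem st j = 0" using l' that by blast
    then show ?thesis using r[OF that(1)] by auto
  qed
  ultimately show ?thesis unfolding linked_def by blast
qed

text \<open>All new entries lie in slot \<open>t\<close> and all old ones before it, so only new
  entries can break feasibility. Among these the machine determines the job through
  \<open>w\<close>, and the job determines the index through \<open>rem\<close>. A newly placed task
  leaves work at least 1, so the sharper bound for finished jobs concerns old entries only.\<close>

lemma slot_recorded:
  assumes v: "valid_instance I" and l: "linked I (rem st) (own st) (mac st)"
    and rc: "recorded I t (rem st) (mac st) (out st)" and f: "feasible I (out st)"
    and s: "slot I t idle st st'" and t: "t \<in> {1..horizon I}"
  shows "recorded I (Suc t) (rem st') (mac st') (out st') \<and> feasible I (out st')"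
proof -
  obtain w where st: "starts I t (num_machines I) idle (rem st) (own st) (mac st) w (mac st')"
    and r: "\<And>j. j \<in> jobs I \<Longrightarrow> rem st' j = (if advancing I t idle w (mac st') j then rem st j - 1
        else if rem st j = 1 then 0 else rem st j)"
    and u: "\<And>j k. j \<in> jobs I \<Longrightarrow> k \<in> {1..job_len I j} \<Longrightarrow> out st' (j, k) =
        (if advancing I t idle w (mac st') j \<and> capacity I (mac st' j) t = 1 \<and>
           k + rem st j = job_len I j + 2
         then (mac st' j, t) else out st (j, k))"
    using s unfolding slot_def by blast
  have M: "i \<noteq> 0" if "i \<in> machines I" for i
    using that unfolding machines_def by auto
  have J: "j \<noteq> 0" if "j \<in> jobs I" for j using that unfolding jobs_def by auto
  note l' = starts_linked[OF v l st, unfolded linked_def] and rc' = rc[unfolded recorded_def]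
  have adv: "2 \<le> rem st j" if "j \<in> jobs I" "advancing I t idle w (mac st') j" for j
    using that l' J[of j] unfolding advancing_def by metis
  have old: "S \<in> available I \<and> fst S = mac st' j \<and> snd S < t \<and> (rem st j = 0 \<longrightarrow> snd S + 1 < t) \<and>
      mac st' j \<noteq> 0 \<and> k + rem st j < job_len I j + 2"
    if "j \<in> jobs I" "k \<in> {1..job_len I j}" "out st (j, k) = S" "S \<noteq> (0, 0)" for j k S
  proof -
    have a: "S \<in> available I \<and> fst S = mac st j \<and> snd S < t \<and> (rem st j = 0 \<longrightarrow> snd S + 1 < t)"
      using rc' that by blast
    then have "mac st j \<noteq> 0" unfolding available_def by auto
    moreover from this have "mac st' j = mac st j" using st that(1) unfolding starts_def by blast
    moreover have "\<not> job_len I j + 2 \<le> k + rem st j" using rc' that by blast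
    ultimately show ?thesis using a by simp
  qed
  have new: "S = (mac st' j, t) \<and> advancing I t idle w (mac st') j \<and> capacity I (mac st' j) t = 1 \<and>
      k + rem st j = job_len I j + 2 \<and> 2 \<le> rem st j"
    if "j \<in> jobs I" "k \<in> {1..job_len I j}" "out st' (j, k) = S" "out st (j, k) \<noteq> S" for j k S
    using u[OF that(1,2)] that adv by (auto split: if_splits)
  have "out st' (j, k) = (0, 0)"
    if "j \<in> jobs I" "k \<in> {1..job_len I j}" "job_len I j + 2 \<le> k + rem st' j" for j k
  proof -
    have "rem st' j \<le> rem st j" using r[OF that(1)] by auto
    then have "out st (j, k) = (0, 0)" using rc' that by fastforce
    moreover have "\<not> (advancing I t idle w (mac st') j \<and> k + rem st j = job_len I j + 2)"
      using r[OF that(1)] that(3) adv[OF that(1)] by auto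
    ultimately show ?thesis using u[OF that(1,2)] by auto
  qed
  moreover have "out st' (j, k) \<in> available I \<and> fst (out st' (j, k)) = mac st' j \<and>
      snd (out st' (j, k)) < Suc t \<and> (rem st' j = 0 \<longrightarrow> snd (out st' (j, k)) + 1 < Suc t)"
    if jk: "j \<in> jobs I" "k \<in> {1..job_len I j}" and n: "out st' (j, k) \<noteq> (0, 0)" for j k
  proof (cases "out st (j, k) = out st' (j, k)")
    case True
    from old[OF jk this n] show ?thesis by auto
  next
    case False
    from new[OF jk refl this] have *: "out st' (j, k) = (mac st' j, t)"
      "advancing I t idle w (mac st') j" "capacity I (mac st' j) t = 1" "2 \<le> rem st j" by auto
    then have "rem st' j \<noteq> 0" using r[OF jk(1)] by auto
    then show ?thesis using * t unfolding available_def advancing_def machines_def by auto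
  qed
  moreover have "(out st' (j, k) = out st' (j', k') \<longrightarrow> j = j' \<and> k = k') \<and>
        (j = j' \<longrightarrow> k < k' \<longrightarrow> snd (out st' (j, k)) < snd (out st' (j', k'))) \<and>
        (job_prec I j j' \<longrightarrow> snd (out st' (j, k)) + 1 < snd (out st' (j', k')))"
    if jk: "j \<in> jobs I" "k \<in> {1..job_len I j}" and jk': "j' \<in> jobs I" "k' \<in> {1..job_len I j'}"
      and n: "out st' (j, k) \<noteq> (0, 0)" and n': "out st' (j', k') \<noteq> (0, 0)" for j k j' k'
  proof -
    \<comment> \<open>A started successor means that \<open>j\<close> had no work left before slot
      \<open>t\<close>, so by \<open>recorded\<close> its tasks lie before slot
      \<open>t - 1\<close>.\<close>
    have p: "rem st j = 0" if "job_prec I j j'" "mac st' j' \<noteq> 0"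
      using l' jk jk' that by blast
    show ?thesis
    proof (cases "out st (j, k) = out st' (j, k)")
      case True
      note o = old[OF jk True n]
      show ?thesis
      proof (cases "out st (j', k') = out st' (j', k')")
        case T': True
        then show ?thesis using f jk jk' n n' True unfolding feasible_def by metis
      next
        case False
        from new[OF jk' refl False] M have "out st' (j', k') = (mac st' j', t)" "mac st' j' \<noteq> 0"
          unfolding advancing_def by auto
        then show ?thesis using o p by auto
      qed
    next
      case False
      note o = new[OF jk refl False]
      show ?thesis
      proof (cases "out st (j', k') = out st' (j', k')")
        case T': True
        note o' = old[OF jk' T' n']
        have "snd (out st' (j, k)) = t" using o by (metis snd_conv)
        moreover from this have "out st' (j, k) \<noteq> out st' (j', k')" using o' by (metis less_irrefl)
        ultimately show ?thesis using o o' p by auto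
      next
        case F': False
        note o' = new[OF jk' refl F']
        have "mac st' j' \<noteq> 0" using o' M unfolding advancing_def by blast
        then have np: "\<not> job_prec I j j'" using o p by auto
        have e: "j = j'" if "out st' (j, k) = out st' (j', k')"
        proof -
          have "mac st' j = mac st' j'" using o o' that by (metis fst_conv)
          then show ?thesis using o o' unfolding advancing_def by metis
        qed
        have "k = k'" if "j = j'" using o o' that by auto
        then show ?thesis using e np by auto
      qed
    qed
  qed
  ultimately show ?thesis unfolding recorded_def feasible_def by blast
qed

lemma slot_consistent:
  assumes "valid_instance I" "consistent I t st" "slot I t idle st st'" "t \<in> {1..horizon I}"
  shows "consistent I (Suc t) st'"
  using assms slot_linked slot_recorded unfolding consistent_def by blast

section \<open>Progress, losses and use of capacity in one slot\<close>

lemma slot_rem_le: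
  assumes "slot I t idle st st'" "j \<in> jobs I"
  shows "rem st' j \<le> rem st j"
  using assms unfolding slot_def by auto

text \<open>In an idle slot every ready job has been given a machine, and idleness lets occupied
  machines advance even without capacity. If only the delay unit is left, it expires anyway.\<close>

lemma slot_idle_source_decreases:
  assumes v: "valid_instance I" and c: "consistent I t st" and s: "slot I t True st st'"
    and j: "j \<in> jobs I" "rem st j \<noteq> 0" "ready I (rem st) j"
  shows "rem st' j < rem st j"
proof -
  obtain w where st: "starts I t (num_machines I) True (rem st) (own st) (mac st) w (mac st')"
    and r: "rem st' j = (if advancing I t True w (mac st') j then rem st j - 1
        else if rem st j = 1 then 0 else rem st j)"
    using s j unfolding slot_def by blast
  have l: "linked I (rem st) w (mac st')"
    using starts_linked[OF v _ st] c unfolding consistent_def by blast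
  have "mac st' j \<noteq> 0" using st j unfolding starts_def by blast
  then have "advancing I t True w (mac st') j" if "2 \<le> rem st j"
    using l j that unfolding linked_def advancing_def by blast
  then show ?thesis using r j(2) by auto
qed

text \<open>The next index of \<open>j\<close> moves past \<open>k\<close> during this slot without
  an entry being written. The expiry of a delay unit moves it from \<open>job_len I j + 1\<close> to
  \<open>job_len I j + 2\<close> and so passes no task.\<close>

definition dropped :: "sched_instance \<Rightarrow> state \<Rightarrow> state \<Rightarrow> (nat \<times> nat) set" where
  "dropped I st st' = {(j, k). j \<in> jobs I \<and> k \<in> {1..job_len I j} \<and>
     job_len I j + 2 \<le> k + rem st j \<and> k + rem st' j < job_len I j + 2 \<and> out st' (j, k) = (0, 0)}"

text \<open>A job passes at most one task per slot and is the only occupant of its machine, so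
  \<open>mac\<close> maps the dropped tasks injectively to machines. With capacity the task would
  have been entered; without it only idleness allows the job to advance.\<close>

lemma slot_dropped:
  assumes v: "valid_instance I" and c: "consistent I t st" and s: "slot I t idle st st'"
  shows "card (dropped I st st') \<le> num_machines I" and "dropped I st st' \<noteq> {} \<Longrightarrow> idle"
proof -
  obtain w where st: "starts I t (num_machines I) idle (rem st) (own st) (mac st) w (mac st')"
    and r: "\<And>j. j \<in> jobs I \<Longrightarrow> rem st' j = (if advancing I t idle w (mac st') j then rem st j - 1
        else if rem st j = 1 then 0 else rem st j)"
    and u: "\<And>j k. j \<in> jobs I \<Longrightarrow> k \<in> {1..job_len I j} \<Longrightarrow> out st' (j, k) =
        (if advancing I t idle w (mac st') j \<and> capacity I (mac st' j) t = 1 \<and>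
           k + rem st j = job_len I j + 2
         then (mac st' j, t) else out st (j, k))"
    using s unfolding slot_def by blast
  have M: "i \<noteq> 0" if "i \<in> machines I" for i
    using that unfolding machines_def by auto
  have d: "advancing I t idle w (mac st') j \<and> k + rem st j = job_len I j + 2 \<and> idle"
    if "(j, k) \<in> dropped I st st'" for j k
  proof -
    have jk: "j \<in> jobs I" "k \<in> {1..job_len I j}" "job_len I j + 2 \<le> k + rem st j"
      "k + rem st' j < job_len I j + 2" "out st' (j, k) = (0, 0)"
      using that unfolding dropped_def by auto
    have a: "advancing I t idle w (mac st') j" "k + rem st j = job_len I j + 2"
      using r[OF jk(1)] jk by (auto split: if_splits)
    moreover from this have "idle"
      using u[OF jk(1,2)] jk(5) M unfolding advancing_def by (auto split: if_splits)
    ultimately show ?thesis by blast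
  qed
  show "dropped I st st' \<noteq> {} \<Longrightarrow> idle" using d by auto
  have "inj_on (\<lambda>a. mac st' (fst a)) (dropped I st st')"
  proof (rule inj_onI)
    fix a b assume a: "a \<in> dropped I st st'" and b: "b \<in> dropped I st st'"
      and e: "mac st' (fst a) = mac st' (fst b)"
    have w: "w (mac st' (fst a)) = fst a" "w (mac st' (fst b)) = fst b"
      and k: "snd a + rem st (fst a) = job_len I (fst a) + 2"
        "snd b + rem st (fst b) = job_len I (fst b) + 2"
      using d[of "fst a" "snd a"] d[of "fst b" "snd b"] a b unfolding advancing_def by auto
    from w e have "fst a = fst b" by metis
    then show "a = b" using k by (simp add: prod_eq_iff)
  qed
  moreover have "(\<lambda>a. mac st' (fst a)) ` dropped I st st' \<subseteq> machines I"
    using d unfolding advancing_def by auto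
  ultimately have "card (dropped I st st') \<le> card (machines I)"
    by (intro card_inj_on_le) (auto simp: machines_def)
  then show "card (dropped I st st') \<le> num_machines I" by (simp add: machines_def)
qed

text \<open>Since the slot is not idle, machine \<open>i\<close> is occupied, and an occupant has
  work at least 2, hence a next task to place.\<close>

lemma slot_busy_used:
  assumes v: "valid_instance I" and c: "consistent I t st" and s: "slot I t False st st'"
    and a: "(i, t) \<in> available I"
  shows "(i, t) \<in> out st' ` tasks I"
proof -
  obtain w where st: "starts I t (num_machines I) False (rem st) (own st) (mac st) w (mac st')"
    and u: "\<And>j k. j \<in> jobs I \<Longrightarrow> k \<in> {1..job_len I j} \<Longrightarrow> out st' (j, k) =
        (if advancing I t False w (mac st') j \<and> capacity I (mac st' j) t = 1 \<and>
           k + rem st j = job_len I j + 2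
         then (mac st' j, t) else out st (j, k))"
    using s unfolding slot_def by blast
  have l: "linked I (rem st) w (mac st')"
    using starts_linked[OF v _ st] c unfolding consistent_def by blast
  have i: "i \<in> machines I" "capacity I i t = 1" using a unfolding available_def machines_def by auto
  then have "w i \<noteq> 0" using st unfolding starts_def machines_def by auto
  then have j: "w i \<in> jobs I" "mac st' (w i) = i" "2 \<le> rem st (w i)" "rem st (w i) \<le> job_len I (w i) + 1"
    using l i unfolding linked_def by blast+
  define k where "k = job_len I (w i) + 2 - rem st (w i)"
  have k: "k \<in> {1..job_len I (w i)}" "k + rem st (w i) = job_len I (w i) + 2"
    using j unfolding k_def by auto
  have "out st' (w i, k) = (i, t)" using u[OF j(1) k(1)] k i j unfolding advancing_def by simp
  moreover have "(w i, k) \<in> tasks I" using j k unfolding tasks_def tasks_of_def by auto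
  ultimately show ?thesis by (metis image_eqI)
qed

text \<open>A nonzero entry has an index below the next one, and a slot writes only at the next
  index.\<close>

lemma slot_out_mono:
  assumes "consistent I t st" "slot I t idle st st'" "a \<in> tasks I" "out st a \<noteq> (0, 0)"
  shows "out st' a = out st a"
proof -
  obtain j k where a: "a = (j, k)" "j \<in> jobs I" "k \<in> {1..job_len I j}"
    using assms(3) unfolding tasks_def tasks_of_def by auto
  have "\<not> job_len I j + 2 \<le> k + rem st j"
    using assms(1,4) a unfolding consistent_def recorded_def by blast
  then show ?thesis using assms(2) a unfolding slot_def by auto
qed

definition initial :: "sched_instance \<Rightarrow> state \<Rightarrow> bool" where
  "initial I st \<longleftrightarrow> (\<forall>j\<in>jobs I. rem st j = job_len I j + 1 \<and> mac st j = 0) \<and>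
     (\<forall>i\<in>machines I. own st i = 0) \<and> (\<forall>a\<in>tasks I. out st a = (0, 0))"

lemma initial_consistent: "initial I st \<Longrightarrow> consistent I 1 st"
  unfolding initial_def consistent_def linked_def recorded_def feasible_def tasks_def tasks_of_def
  by auto

lemma sum_chain_le_Delta:
  assumes "is_chain I C"
  shows "(\<Sum>j\<in>C. job_len I j) \<le> Delta I"
proof -
  have "{(\<Sum>j\<in>C. job_len I j) | C. is_chain I C} \<subseteq> (\<lambda>C. \<Sum>j\<in>C. job_len I j) ` Pow (jobs I)"
    unfolding is_chain_def by auto
  then have "finite {(\<Sum>j\<in>C. job_len I j) | C. is_chain I C}"
    by (rule finite_subset) (simp add: jobs_def)
  then show ?thesis unfolding Delta_def using assms by (intro Max_ge) auto
qed

section \<open>Counting the discarded tasks\<close>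

text \<open>\<open>st t\<close> is the state before slot \<open>t\<close>, so the result is
  \<open>st (Suc (horizon I))\<close>; \<open>st 0\<close> is unconstrained.\<close>

locale greedy_run =
  fixes I :: sched_instance and st :: "nat \<Rightarrow> state" and idle :: "nat \<Rightarrow> bool"
  assumes valid: "valid_instance I"
    and init: "initial I (st 1)"
    and step: "\<And>t. t \<in> {1..horizon I} \<Longrightarrow> slot I t (idle t) (st t) (st (Suc t))"
begin

lemma consistent: "t \<le> horizon I \<Longrightarrow> consistent I (Suc t) (st (Suc t))"
proof (induction t)
  case 0
  then show ?case using initial_consistent[OF init] by simp
next
  case (Suc t)
  then show ?case using slot_consistent[OF valid _ step[of "Suc t"]] by simp
qed

lemma consistent': "t \<in> {1..horizon I} \<Longrightarrow> consistent I t (st t)"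
  using consistent[of "t - 1"] by (cases t) auto

lemma rem_antimono:
  assumes "j \<in> jobs I" "1 \<le> u" "u \<le> v" "v \<le> Suc (horizon I)"
  shows "rem (st v) j \<le> rem (st u) j"
  using assms(3,4)
proof (induction v rule: dec_induct)
  case (step n)
  then have "rem (st (Suc n)) j \<le> rem (st n) j"
    using slot_rem_le[OF greedy_run.step[OF greedy_run_axioms, of n]] assms(1,2) by simp
  then show ?case using step by simp
qed simp

lemma out_mono:
  assumes "a \<in> tasks I" "1 \<le> u" "u \<le> v" "v \<le> Suc (horizon I)" "out (st u) a \<noteq> (0, 0)"
  shows "out (st v) a = out (st u) a"
  using assms(3,4)
proof (induction v rule: dec_induct)
  case (step n)
  then show ?case
    using slot_out_mono[OF consistent' greedy_run.step[OF greedy_run_axioms, of n]] assms by simp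
qed simp

text \<open>Idle slots after the end of all work are left out, because no chain weight remains to
  pay for them.\<close>

definition wasted :: "nat set" where
  "wasted = {t \<in> {1..horizon I}. idle t \<and> (\<exists>j\<in>jobs I. rem (st t) j \<noteq> 0)}"

text \<open>Bounding each chain after the slot by some heavier chain before it expresses the
  decrease of the maximum without forming a maximum. If the first unfinished job \<open>x\<close> of
  the chain is ready, it loses a unit itself; otherwise an unfinished predecessor \<open>y\<close>
  of \<open>x\<close> can be put in front, and its weight makes the difference.\<close>

lemma idle_chain:
  assumes t: "t \<in> {1..horizon I}" "idle t" and j: "j \<in> jobs I" "rem (st t) j \<noteq> 0"
    and C: "is_chain I C"
  shows "\<exists>C'. is_chain I C' \<and> (\<Sum>j\<in>C. rem (st (Suc t)) j) < (\<Sum>j\<in>C'. rem (st t) j)"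
proof -
  have fin: "finite (jobs I)" by (simp add: jobs_def)
  have tr: "transp_on (jobs I) (job_prec I)" and irr: "irreflp_on (jobs I) (job_prec I)"
    using valid unfolding valid_instance_def by auto
  have le: "rem (st (Suc t)) j \<le> rem (st t) j" if "j \<in> jobs I" for j
    using slot_rem_le[OF step[OF t(1)] that] .
  \<comment> \<open>Finished members weigh nothing, and without them a minimal element is the first
    unfinished job of the chain.\<close>
  define B where "B = {j \<in> C. rem (st t) j \<noteq> 0}"
  have BC: "B \<subseteq> C" "C \<subseteq> jobs I" using C unfolding B_def is_chain_def by auto
  have finB: "finite B" "finite C" using BC fin by (auto intro: finite_subset)
  have B: "is_chain I B" using C BC unfolding is_chain_def by blast
  have z: "rem (st (Suc t)) j = 0" if "j \<in> C - B" for j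
    using that le[of j] BC unfolding B_def by auto
  have S: "(\<Sum>j\<in>C. rem (st (Suc t)) j) = (\<Sum>j\<in>B. rem (st (Suc t)) j)"
    using sum.mono_neutral_right[OF finB(2) BC(1)] z by auto
  show ?thesis
  proof (cases "B = {}")
    case True
    \<comment> \<open>No weight is left in \<open>C\<close>, so any single job with work left
      outweighs it.\<close>
    have "is_chain I {j}" using j unfolding is_chain_def by auto
    moreover have "(\<Sum>j\<in>C. rem (st (Suc t)) j) < (\<Sum>j\<in>{j}. rem (st t) j)" using S True j by simp
    ultimately show ?thesis by blast
  next
    case False
    have "\<exists>x\<in>B. \<forall>y\<in>B. y \<noteq> x \<longrightarrow> \<not> job_prec I y x"
      using Finite_Set.bex_min_element[OF finB(1), of "job_prec I"] False tr irr BC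
      by (metis asymp_on_iff_irreflp_on_if_transp_on asymp_on_subset order_trans transp_on_subset)
    then obtain x where x: "x \<in> B" "\<And>y. y \<in> B \<Longrightarrow> \<not> job_prec I y x"
      using irr BC by (metis irreflp_on_def subsetD)
    show ?thesis
    proof (cases "ready I (rem (st t)) x")
      case True
      have "slot I t True (st t) (st (Suc t))" using step[OF t(1)] t(2) by simp
      then have "rem (st (Suc t)) x < rem (st t) x"
        using slot_idle_source_decreases[OF valid consistent'[OF t(1)]] x(1) True BC
        unfolding B_def by blast
      then have "(\<Sum>j\<in>B. rem (st (Suc t)) j) < (\<Sum>j\<in>B. rem (st t) j)"
        using x(1) le BC finB by (intro sum_strict_mono_ex1) auto
      then show ?thesis using S B by auto
    next
      case False
      then obtain y where y: "y \<in> jobs I" "job_prec I y x" "rem (st t) y \<noteq> 0"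
        unfolding ready_def by blast
      have yB: "y \<notin> B" using x y by blast
      have "job_prec I y z" if "z \<in> B" for z
      proof (cases "z = x")
        case False
        then have "job_prec I x z" using B x that unfolding is_chain_def by blast
        then show ?thesis using tr y x that BC unfolding transp_on_def by blast
      qed (use y in simp)
      then have "is_chain I (insert y B)" using B y unfolding is_chain_def by blast
      moreover have "(\<Sum>j\<in>B. rem (st (Suc t)) j) \<le> (\<Sum>j\<in>B. rem (st t) j)"
        using le BC by (intro sum_mono) auto
      then have "(\<Sum>j\<in>B. rem (st (Suc t)) j) < (\<Sum>j\<in>insert y B. rem (st t) j)"
        using yB y finB by simp
      ultimately show ?thesis using S by auto
    qed
  qed
qed

text \<open>The induction runs backwards in time because \<open>idle_chain\<close> produces the
  earlier chain from the later one; the chain may change in every wasted slot.\<close>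

lemma wasted_chain:
  assumes "u \<le> horizon I"
  shows "\<exists>C. is_chain I C \<and>
    card (wasted \<inter> {Suc (horizon I - u)..}) \<le> (\<Sum>j\<in>C. rem (st (Suc (horizon I - u))) j)"
  using assms
proof (induction u)
  case 0
  have "wasted \<inter> {Suc (horizon I)..} = {}" unfolding wasted_def by auto
  moreover have "is_chain I {}" unfolding is_chain_def by simp
  ultimately show ?case by (intro exI[of _ "{}"]) simp
next
  case (Suc u)
  define t where "t = horizon I - u"
  have t: "t \<in> {1..horizon I}" "Suc (horizon I - Suc u) = t" using Suc.prems unfolding t_def by auto
  obtain C where C: "is_chain I C"
    "card (wasted \<inter> {Suc t..}) \<le> (\<Sum>j\<in>C. rem (st (Suc t)) j)"
    using Suc unfolding t_def by auto
  have fw: "finite wasted" unfolding wasted_def by auto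
  show ?case unfolding t(2)
  proof (cases "t \<in> wasted")
    case True
    then obtain j where "idle t" "j \<in> jobs I" "rem (st t) j \<noteq> 0" unfolding wasted_def by blast
    from idle_chain[OF t(1) this C(1)] obtain C' where C': "is_chain I C'"
      "(\<Sum>j\<in>C. rem (st (Suc t)) j) < (\<Sum>j\<in>C'. rem (st t) j)" by blast
    have "wasted \<inter> {t..} = insert t (wasted \<inter> {Suc t..})" using True by auto
    then have "card (wasted \<inter> {t..}) = Suc (card (wasted \<inter> {Suc t..}))" using fw by simp
    then show "\<exists>C. is_chain I C \<and> card (wasted \<inter> {t..}) \<le> (\<Sum>j\<in>C. rem (st t) j)"
      using C C' by (intro exI[of _ C']) simp
  next
    case False
    moreover have "{t..} = insert t {Suc t..}" by auto
    ultimately have "wasted \<inter> {t..} = wasted \<inter> {Suc t..}" by simp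
    moreover have "(\<Sum>j\<in>C. rem (st (Suc t)) j) \<le> (\<Sum>j\<in>C. rem (st t) j)"
      using slot_rem_le[OF step[OF t(1)]] C(1) unfolding is_chain_def by (intro sum_mono) auto
    ultimately show "\<exists>C. is_chain I C \<and> card (wasted \<inter> {t..}) \<le> (\<Sum>j\<in>C. rem (st t) j)"
      using C by (intro exI[of _ C]) simp
  qed
qed

lemma card_wasted: "card wasted \<le> 2 * Delta I"
proof -
  obtain C where C: "is_chain I C" "card (wasted \<inter> {1..}) \<le> (\<Sum>j\<in>C. rem (st 1) j)"
    using wasted_chain[of "horizon I"] by auto
  have J: "C \<subseteq> jobs I" using C(1) unfolding is_chain_def by simp
  \<comment> \<open>The factor 2 arises here: the delay unit at most doubles a positive job
    length.\<close>
  have "rem (st 1) j \<le> 2 * job_len I j" if "j \<in> C" for j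
  proof -
    have "rem (st 1) j = job_len I j + 1" "1 \<le> job_len I j"
      using that J init valid unfolding initial_def valid_instance_def by auto
    then show ?thesis by simp
  qed
  then have "(\<Sum>j\<in>C. rem (st 1) j) \<le> 2 * (\<Sum>j\<in>C. job_len I j)"
    by (simp add: sum_distrib_left sum_mono)
  moreover have "wasted \<inter> {1..} = wasted" unfolding wasted_def by auto
  ultimately show ?thesis using C sum_chain_le_Delta[OF C(1)] by simp
qed

section \<open>The final schedule and the size of the discarded set\<close>

definition final :: "nat \<times> nat \<Rightarrow> nat \<times> nat" where
  "final = out (st (Suc (horizon I)))"

definition discarded :: "(nat \<times> nat) set" where
  "discarded = {a \<in> tasks I. final a = (0, 0)}"

lemma finite_tasks: "finite (tasks I)"
  unfolding tasks_def tasks_of_def jobs_def by auto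

lemma discarded_if_unfinished:
  assumes S: "relaxed_assignment I S'"
    and j: "j \<in> jobs I" "rem (st (Suc (horizon I))) j \<noteq> 0"
  shows "card discarded \<le> num_machines I * card wasted"
proof -
  have w: "t \<in> wasted" if t: "t \<in> {1..horizon I}" "idle t" for t
  proof -
    have "rem (st (Suc (horizon I))) j \<le> rem (st t) j"
      using rem_antimono[OF j(1), of t "Suc (horizon I)"] t(1) by simp
    then have "rem (st t) j \<noteq> 0" using j(2) by linarith
    then show ?thesis unfolding wasted_def using that j(1) by blast
  qed
  have "available I \<subseteq> final ` (tasks I - discarded) \<union> machines I \<times> wasted"
  proof
    fix x assume x: "x \<in> available I"
    obtain i t where it: "x = (i, t)" by fastforce
    have t: "t \<in> {1..horizon I}" and i: "i \<in> machines I"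
      using x it unfolding available_def machines_def by auto
    show "x \<in> final ` (tasks I - discarded) \<union> machines I \<times> wasted"
    proof (cases "idle t")
      case True
      then show ?thesis using w t i it by simp
    next
      case False
      then have "(i, t) \<in> out (st (Suc t)) ` tasks I"
        using slot_busy_used[OF valid consistent'[OF t]] step[OF t] x it by simp
      then obtain a where a: "a \<in> tasks I" "out (st (Suc t)) a = (i, t)" by auto
      then have "out (st (Suc t)) a \<noteq> (0, 0)" using t by auto
      then have "final a = (i, t)"
        using out_mono[OF a(1), of "Suc t" "Suc (horizon I)"] a t unfolding final_def by simp
      then show ?thesis using a it t unfolding discarded_def by force
    qed
  qed
  then have "card (available I) \<le> card (final ` (tasks I - discarded) \<union> machines I \<times> wasted)"
    using finite_tasks by (intro card_mono) (auto simp: machines_def wasted_def)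
  also have "\<dots> \<le> card (tasks I - discarded) + num_machines I * card wasted"
    using finite_tasks
    by (intro order_trans[OF card_Un_le] add_mono card_image_le)
      (auto simp: card_cartesian_product machines_def)
  finally have 1: "card (available I) \<le> card (tasks I - discarded) + num_machines I * card wasted" .
  have "finite (available I)"
    by (rule finite_subset[of _ "{1..num_machines I} \<times> {1..horizon I}"]) (auto simp: available_def)
  then have "card (tasks I) \<le> card (available I)"
    using S unfolding relaxed_assignment_def by (metis card_inj_on_le)
  moreover have "card (tasks I) = card (tasks I - discarded) + card discarded"
    using finite_tasks by (metis (no_types, lifting) card_Diff_subset card_mono discarded_def
        finite_subset le_add_diff_inverse2 mem_Collect_eq subsetI)
  ultimately show ?thesis using 1 by simp
qed

text \<open>Each discarded task is charged to the slot in which the next index of its job first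
  moves past it; that slot dropped it and is therefore idle.\<close>

lemma discarded_if_finished:
  assumes "\<And>j. j \<in> jobs I \<Longrightarrow> rem (st (Suc (horizon I))) j = 0"
  shows "card discarded \<le> num_machines I * card wasted"
proof -
  have "discarded \<subseteq> (\<Union>t\<in>wasted. dropped I (st t) (st (Suc t)))"
  proof
    fix a assume a: "a \<in> discarded"
    then obtain j k where jk: "a = (j, k)" "j \<in> jobs I" "k \<in> {1..job_len I j}"
      unfolding discarded_def tasks_def tasks_of_def by auto
    \<comment> \<open>\<open>P t\<close> says that index \<open>k\<close> was passed before slot
      \<open>t\<close>. The conjunct \<open>t \<noteq> 0\<close> keeps the unconstrained
      \<open>st 0\<close> out of the minimum.\<close>
    define P where "P t \<longleftrightarrow> t \<noteq> 0 \<and> k + rem (st t) j < job_len I j + 2" for t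
    have P: "P (Suc (horizon I))" using assms jk unfolding P_def by simp
    define v where "v = (LEAST t. P t)"
    have v: "P v" "v \<le> Suc (horizon I)" "\<And>u. u < v \<Longrightarrow> \<not> P u"
      unfolding v_def using P by (auto intro: LeastI Least_le dest: not_less_Least)
    have "\<not> P 1" using init jk unfolding P_def initial_def by simp
    then have "v \<noteq> 0 \<and> v \<noteq> 1" using v(1) unfolding P_def by metis
    then obtain t where t: "v = Suc t" "t \<noteq> 0" by (metis One_nat_def not0_implies_Suc)
    then have tT: "t \<in> {1..horizon I}" using v(2) by auto
    have "\<not> P t" using v(3)[of t] t by simp
    have o: "out (st (Suc t)) a = (0, 0)"
    proof (rule ccontr)
      assume "out (st (Suc t)) a \<noteq> (0, 0)"
      then show False using out_mono[of a "Suc t" "Suc (horizon I)"] a tT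
        unfolding discarded_def final_def by auto
    qed
    have d: "a \<in> dropped I (st t) (st (Suc t))"
      using jk o \<open>\<not> P t\<close> t v(1) unfolding dropped_def P_def by auto
    moreover have "t \<in> wasted"
    proof -
      have "idle t" using slot_dropped(2)[OF valid consistent'[OF tT] step[OF tT]] d by blast
      moreover have "rem (st t) j \<noteq> 0" using \<open>\<not> P t\<close> t jk unfolding P_def by auto
      ultimately show ?thesis using tT jk unfolding wasted_def by blast
    qed
    ultimately show "a \<in> (\<Union>t\<in>wasted. dropped I (st t) (st (Suc t)))" by blast
  qed
  moreover have fw: "finite wasted" unfolding wasted_def by auto
  moreover have "finite (dropped I (st t) (st (Suc t)))" for t
    by (rule finite_subset[OF _ finite_tasks]) (auto simp: dropped_def tasks_def tasks_of_def)
  ultimately have "card discarded \<le> card (\<Union>t\<in>wasted. dropped I (st t) (st (Suc t)))"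
    by (intro card_mono) auto
  also have "\<dots> \<le> (\<Sum>t\<in>wasted. card (dropped I (st t) (st (Suc t))))"
    by (rule card_UN_le[OF fw])
  also have "\<dots> \<le> (\<Sum>t\<in>wasted. num_machines I)"
    using slot_dropped(1)[OF valid consistent' step] by (intro sum_mono) (auto simp: wasted_def)
  finally show ?thesis by (simp add: mult.commute)
qed

lemma card_discarded:
  assumes "relaxed_assignment I S'"
  shows "card discarded \<le> 2 * num_machines I * Delta I"
proof -
  have "card discarded \<le> num_machines I * card wasted"
    using discarded_if_unfinished[OF assms] discarded_if_finished by blast
  also have "\<dots> \<le> num_machines I * (2 * Delta I)" using card_wasted by (rule mult_le_mono2)
  finally show ?thesis by (simp add: ac_simps)
qed

lemma final_schedule:
  shows "\<forall>a\<in>tasks I - discarded. final a \<in> available I"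
    and "inj_on final (tasks I - discarded)"
    and "\<forall>j\<in>jobs I. \<forall>a\<in>tasks_of I j - discarded. \<forall>a'\<in>tasks_of I j - discarded.
      fst (final a) = fst (final a')"
    and "\<forall>a\<in>tasks I - discarded. \<forall>a'\<in>tasks I - discarded.
      task_prec I a a' \<longrightarrow> snd (final a) < snd (final a')"
    and "\<forall>j\<in>jobs I. \<forall>j'\<in>jobs I. job_prec I j j' \<and> (j, job_len I j) \<notin> discarded \<and>
      (j', 1) \<notin> discarded \<longrightarrow> snd (final (j', 1)) > snd (final (j, job_len I j)) + 1"
proof -
  have mem: "(j, k) \<in> tasks I \<longleftrightarrow> j \<in> jobs I \<and> k \<in> {1..job_len I j}" for j k
    unfolding tasks_def tasks_of_def by auto
  have mem': "(j, k) \<in> tasks_of I j' \<longleftrightarrow> j = j' \<and> k \<in> {1..job_len I j}" for j k j'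
    unfolding tasks_of_def by auto
  have len: "1 \<le> job_len I j" if "j \<in> jobs I" for j
    using valid that unfolding valid_instance_def by blast
  have nz: "final (j, k) \<noteq> (0, 0)"
    if "j \<in> jobs I" "k \<in> {1..job_len I j}" "(j, k) \<notin> discarded" for j k
    using that mem unfolding discarded_def by auto
  have c: "consistent I (Suc (horizon I)) (st (Suc (horizon I)))" using consistent by blast
  then have rec: "final (j, k) \<in> available I \<and> fst (final (j, k)) = mac (st (Suc (horizon I))) j"
    if "j \<in> jobs I" "k \<in> {1..job_len I j}" "(j, k) \<notin> discarded" for j k
    using that nz[OF that] unfolding consistent_def recorded_def final_def[symmetric] by blast
  have fea: "(final (j, k) = final (j', k') \<longrightarrow> j = j' \<and> k = k') \<and>
        (j = j' \<longrightarrow> k < k' \<longrightarrow> snd (final (j, k)) < snd (final (j', k'))) \<and>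
        (job_prec I j j' \<longrightarrow> snd (final (j, k)) + 1 < snd (final (j', k')))"
    if "j \<in> jobs I" "k \<in> {1..job_len I j}" "(j, k) \<notin> discarded"
      "j' \<in> jobs I" "k' \<in> {1..job_len I j'}" "(j', k') \<notin> discarded" for j k j' k'
    using c that nz[OF that(1-3)] nz[OF that(4-6)]
    unfolding consistent_def feasible_def final_def[symmetric] by blast
  show "\<forall>a\<in>tasks I - discarded. final a \<in> available I" using rec mem by auto
  show "inj_on final (tasks I - discarded)" using fea mem by (auto intro!: inj_onI)
  show "\<forall>j\<in>jobs I. \<forall>a\<in>tasks_of I j - discarded. \<forall>a'\<in>tasks_of I j - discarded.
      fst (final a) = fst (final a')" using rec mem' by auto
  show "\<forall>a\<in>tasks I - discarded. \<forall>a'\<in>tasks I - discarded.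
      task_prec I a a' \<longrightarrow> snd (final a) < snd (final a')"
  proof (intro ballI impI)
    fix a a' assume a: "a \<in> tasks I - discarded" "a' \<in> tasks I - discarded" "task_prec I a a'"
    obtain j k j' k' where e: "a = (j, k)" "a' = (j', k')" by fastforce
    show "snd (final a) < snd (final a')"
      using fea[of j k j' k'] a unfolding e mem task_prec_def Diff_iff by auto
  qed
  show "\<forall>j\<in>jobs I. \<forall>j'\<in>jobs I. job_prec I j j' \<and> (j, job_len I j) \<notin> discarded \<and>
      (j', 1) \<notin> discarded \<longrightarrow> snd (final (j', 1)) > snd (final (j, job_len I j)) + 1"
    using fea len by auto
qed

end

section \<open>Weakest preconditions with a time budget\<close>

text \<open>The postcondition may refer to the unused part of the budget.\<close>

definition runs :: "com \<Rightarrow> store \<Rightarrow> nat \<Rightarrow> (store \<Rightarrow> nat \<Rightarrow> bool) \<Rightarrow> bool" where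
  "runs c s b Q \<longleftrightarrow> (\<exists>t s'. exec c s t s' \<and> t \<le> b \<and> Q s' (b - t))"

text \<open>As equations, these rules let the simplifier compute weakest preconditions of
  straight-line code; the direction from left to right rests on determinism of
  \<open>exec\<close>.\<close>

lemma runs_Skip [simp]: "runs Skip s b Q \<longleftrightarrow> 1 \<le> b \<and> Q s (b - 1)"
  unfolding runs_def by (metis exec.Skip exec_deterministic)

lemma runs_Assign [simp]:
  "runs (Assign x e f) s b Q \<longleftrightarrow> acost e + acost f + 1 \<le> b \<and>
     Q (s(x := (s x)(aval e s := aval f s))) (b - (acost e + acost f + 1))"
  unfolding runs_def by (metis exec.Assign exec_deterministic)

lemma runs_Seq [simp]: "runs (Seq c d) s b Q \<longleftrightarrow> runs c s b (\<lambda>s' b'. runs d s' b' Q)"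
proof
  assume "runs (Seq c d) s b Q"
  then obtain t s' where t: "exec (Seq c d) s t s'" "t \<le> b" "Q s' (b - t)" unfolding runs_def by blast
  from t(1) obtain t1 t2 s1 where "exec c s t1 s1" "exec d s1 t2 s'" "t = t1 + t2"
    by (rule SeqE) blast
  then show "runs c s b (\<lambda>s' b'. runs d s' b' Q)"
    using t(2,3) unfolding runs_def
    by (intro exI[of _ t1] exI[of _ s1] conjI exI[of _ t2] exI[of _ s']) auto
next
  assume "runs c s b (\<lambda>s' b'. runs d s' b' Q)"
  then obtain t1 s1 t2 s2 where "exec c s t1 s1" "t1 \<le> b" "exec d s1 t2 s2" "t2 \<le> b - t1"
    "Q s2 (b - t1 - t2)" unfolding runs_def by blast
  then show "runs (Seq c d) s b Q"
    unfolding runs_def by (intro exI[of _ "t1 + t2"] exI[of _ s2]) (auto intro: exec.Seq)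
qed

lemma runs_Cond [simp]:
  "runs (Cond e c d) s b Q \<longleftrightarrow> bcost e \<le> b \<and>
     (if bval e s then runs c s (b - bcost e) Q else runs d s (b - bcost e) Q)"
  (is "?L \<longleftrightarrow> ?R")
proof
  assume ?L
  then obtain t s' where t: "exec (Cond e c d) s t s'" "t \<le> b" "Q s' (b - t)" unfolding runs_def by blast
  from t(1) show ?R
    by (rule CondE) (use t(2,3) in \<open>auto simp: runs_def intro!: exI\<close>)
next
  assume ?R
  then obtain t s' where "if bval e s then exec c s t s' else exec d s t s'" "bcost e \<le> b"
    "t \<le> b - bcost e" "Q s' (b - bcost e - t)" unfolding runs_def by (auto split: if_splits)
  then show ?L
    unfolding runs_def by (intro exI[of _ "bcost e + t"] exI[of _ s'])
      (auto intro: exec.CondTrue exec.CondFalse split: if_splits)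
qed

lemma runs_mono:
  assumes "runs c s b Q" "b \<le> b'" "\<And>s' u u'. Q s' u \<Longrightarrow> u \<le> u' \<Longrightarrow> Q' s' u'"
  shows "runs c s b' Q'"
proof -
  obtain t s' where t: "exec c s t s'" "t \<le> b" "Q s' (b - t)" using assms(1) unfolding runs_def by blast
  then have "Q' s' (b' - t)" using assms(2,3) diff_le_mono by blast
  then show ?thesis using t assms(2) unfolding runs_def by (meson order_trans)
qed

text \<open>Fixing the budget \<open>b2\<close> at the seam allows the second command to be verified
  for one concrete budget instead of whatever is left over.\<close>

lemma runs_SeqI:
  assumes "runs c s b (\<lambda>s' b'. R s' \<and> b2 \<le> b')" "\<And>s'. R s' \<Longrightarrow> runs d s' b2 (\<lambda>s' _. Q s')"
  shows "runs (Seq c d) s b (\<lambda>s' _. Q s')"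
  unfolding runs_Seq
proof (rule runs_mono[OF assms(1) order_refl])
  fix s' u u' assume "R s' \<and> b2 \<le> u" "u \<le> u'"
  then show "runs d s' u' (\<lambda>s' _. Q s')" by (intro runs_mono[OF assms(2)]) auto
qed

text \<open>The counter takes the values 1 to \<open>e\<close>, matching the numbering of jobs,
  machines and slots. The bound is evaluated anew in each round, so its value must be
  invariant.\<close>

definition For :: "nat \<Rightarrow> aexp \<Rightarrow> com \<Rightarrow> com" where
  "For x e c = Seq (Assign x (Const 0) (Const 1))
     (While (Neg (Less e (Cell x (Const 0))))
       (Seq c (Assign x (Const 0) (Add (Cell x (Const 0)) (Const 1)))))"

text \<open>\<open>P k\<close> holds after \<open>k\<close> rounds, when the counter is
  \<open>k + 1\<close>. With \<open>acost e = 2\<close> the test costs 6 and the increment 6, hence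
  12 per round beside the body, plus 6 for the final failing test.\<close>

lemma While_runs:
  assumes "P k s" "s x 0 = Suc k" "k \<le> n" "acost e = 2"
    and e: "\<And>k s. P k s \<Longrightarrow> aval e s = n"
    and body: "\<And>k s. k < n \<Longrightarrow> P k s \<Longrightarrow> s x 0 = Suc k \<Longrightarrow>
      runs c s b (\<lambda>s' _. s' x 0 = Suc k \<and> P (Suc k) s')"
    and upd: "\<And>k s v. P k s \<Longrightarrow> P k (s(x := (s x)(0 := v)))"
  shows "\<exists>t s'. exec (While (Neg (Less e (Cell x (Const 0))))
       (Seq c (Assign x (Const 0) (Add (Cell x (Const 0)) (Const 1))))) s t s' \<and>
     t \<le> (n - k) * (b + 12) + 6 \<and> P n s'"
  using assms(1-3)
proof (induction "n - k" arbitrary: k s)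
  case 0
  then have "\<not> bval (Neg (Less e (Cell x (Const 0)))) s" using e by simp
  from exec.WhileFalse[OF this] show ?case using 0 assms(4)
    by (intro exI[of _ 6] exI[of _ s]) auto
next
  case (Suc m)
  let ?b = "Neg (Less e (Cell x (Const 0)))"
  let ?i = "Assign x (Const 0) (Add (Cell x (Const 0)) (Const 1))"
  have k: "k < n" using Suc by simp
  obtain t s' where s': "exec c s t s'" "t \<le> b" "s' x 0 = Suc k" "P (Suc k) s'"
    using body[OF k Suc.prems(1,2)] unfolding runs_def by blast
  define s2 where "s2 = s'(x := (s' x)(0 := Suc (Suc k)))"
  have "exec ?i s' 6 s2"
    using exec.Assign[of x "Const 0" "Add (Cell x (Const 0)) (Const 1)" s'] s'(3)
    by (simp add: s2_def eval_nat_numeral)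
  then have c: "exec (Seq c ?i) s (t + 6) s2" using s'(1) by (rule exec.Seq[rotated])
  have "P (Suc k) s2" "s2 x 0 = Suc (Suc k)" using upd[OF s'(4)] by (auto simp: s2_def)
  moreover have "m = n - Suc k" using Suc.hyps(2) by simp
  ultimately obtain u s3 where u: "exec (While ?b (Seq c ?i)) s2 u s3"
    "u \<le> (n - Suc k) * (b + 12) + 6" "P n s3"
    using Suc.hyps(1)[of "Suc k" s2] k by auto
  have "bval ?b s" using e[OF Suc.prems(1)] Suc.prems k by simp
  from exec.WhileTrue[OF this c u(1)] have w: "exec (While ?b (Seq c ?i)) s (bcost ?b + (t + 6) + u) s3" .
  have "n - k = Suc (n - Suc k)" using k by simp
  then have "bcost ?b + (t + 6) + u \<le> (n - k) * (b + 12) + 6"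
    using u(2) s'(2) assms(4) by simp
  then show ?case using w u(3) by blast
qed

text \<open>The constant 9 is the failing test, 6, plus the initialisation of the counter, 3. The
  arbitrary \<open>Q\<close>, which also sees the remaining budget, lets the rule apply when further
  code follows.\<close>

lemma For_runs:
  assumes P0: "P 0 s" and "acost e = 2"
    and e: "\<And>k s. P k s \<Longrightarrow> aval e s = n"
    and body: "\<And>k s. k < n \<Longrightarrow> P k s \<Longrightarrow> s x 0 = Suc k \<Longrightarrow>
      runs c s b (\<lambda>s' _. s' x 0 = Suc k \<and> P (Suc k) s')"
    and upd: "\<And>k s v. P k s \<Longrightarrow> P k (s(x := (s x)(0 := v)))"
    and B: "n * (b + 12) + 9 \<le> B"
    and Q: "\<And>s' B'. P n s' \<Longrightarrow> B - (n * (b + 12) + 9) \<le> B' \<Longrightarrow> Q s' B'"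
  shows "runs (For x e c) s B Q"
proof -
  let ?s = "s(x := (s x)(0 := Suc 0))"
  obtain t s' where t: "exec (While (Neg (Less e (Cell x (Const 0))))
       (Seq c (Assign x (Const 0) (Add (Cell x (Const 0)) (Const 1))))) ?s t s'"
     "t \<le> n * (b + 12) + 6" "P n s'"
    using While_runs[of P 0 ?s x n e c b] assms by auto
  have "exec (Assign x (Const 0) (Const 1)) s 3 ?s"
    using exec.Assign[of x "Const 0" "Const 1" s] by (simp add: eval_nat_numeral)
  from exec.Seq[OF this t(1)] have "exec (For x e c) s (3 + t) s'" unfolding For_def .
  moreover have "3 + t \<le> B" "Q s' (B - (3 + t))" using t(2) B Q[OF t(3), of "B - (3 + t)"] by auto
  ultimately show ?thesis unfolding runs_def by blast
qed

section \<open>The program for one slot\<close>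

text \<open>
  Array names; the names ending in \<open>V\<close> are loop counters. \<open>PRB j + j'\<close> and \<open>CPB i + t\<close> are the input
  cells of \<open>job_prec j j'\<close> and \<open>capacity i t\<close>, and the output of job \<open>j\<close> starts at cell \<open>OFF j\<close>.
\<close>

abbreviation (input) "INP \<equiv> 0 :: nat"
abbreviation (input) "OUT \<equiv> 1 :: nat"
abbreviation (input) "HOR \<equiv> 2 :: nat"
abbreviation (input) "LEN \<equiv> 3 :: nat"
abbreviation (input) "PRB \<equiv> 4 :: nat"
abbreviation (input) "CPB \<equiv> 5 :: nat"
abbreviation (input) "OFF \<equiv> 6 :: nat"
abbreviation (input) "REM \<equiv> 7 :: nat"
abbreviation (input) "MAC \<equiv> 8 :: nat"
abbreviation (input) "OWN \<equiv> 9 :: nat"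
abbreviation (input) "PTR \<equiv> 10 :: nat"
abbreviation (input) "ACC \<equiv> 11 :: nat"
abbreviation (input) "IDL \<equiv> 12 :: nat"
abbreviation (input) "RDY \<equiv> 13 :: nat"
abbreviation (input) "TV \<equiv> 20 :: nat"
abbreviation (input) "IV \<equiv> 21 :: nat"
abbreviation (input) "JV \<equiv> 22 :: nat"
abbreviation (input) "LV \<equiv> 23 :: nat"

abbreviation (input) var :: "nat \<Rightarrow> aexp" where "var x \<equiv> Cell x (Const 0)"
abbreviation (input) set_var :: "nat \<Rightarrow> aexp \<Rightarrow> com" where "set_var x e \<equiv> Assign x (Const 0) e"
abbreviation (input) machine_count :: aexp where "machine_count \<equiv> Cell INP (Const 0)"
abbreviation (input) job_count :: aexp where "job_count \<equiv> Cell INP (Const 3)"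
abbreviation (input) is_zero :: "aexp \<Rightarrow> bexp" where "is_zero e \<equiv> Equal e (Const 0)"
abbreviation (input) is_one :: "aexp \<Rightarrow> bexp" where "is_one e \<equiv> Equal e (Const 1)"
abbreviation (input) cap_now :: aexp where "cap_now \<equiv> Cell INP (Add (Cell CPB (var IV)) (var TV))"

definition ready_code :: com where
  "ready_code = Seq (set_var RDY (Const 1)) (For LV job_count
     (Cond (Conj (is_one (Cell INP (Add (Cell PRB (var LV)) (var JV))))
                 (Neg (is_zero (Cell REM (var LV)))))
        (set_var RDY (Const 0)) Skip))"

text \<open>There is no early exit: once the machine is occupied, the guard disables all later
  rounds.\<close>

definition pick_code :: com where
  "pick_code = For JV job_count
     (Cond (Conj (is_zero (Cell OWN (var IV))) (is_zero (Cell MAC (var JV))))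
        (Seq ready_code (Cond (is_one (var RDY))
          (Seq (Assign OWN (var IV) (var JV)) (Assign MAC (var JV) (var IV))) Skip))
        Skip)"

definition start_code :: com where
  "start_code = Seq (set_var IDL (Const 0)) (For IV machine_count
     (Cond (Conj (is_zero (Cell OWN (var IV))) (is_one cap_now))
       (Seq pick_code (Cond (is_zero (Cell OWN (var IV))) (set_var IDL (Const 1)) Skip))
       Skip))"

definition tick_code :: com where
  "tick_code = For JV job_count
     (Cond (is_one (Cell REM (var JV))) (Assign REM (var JV) (Const 0)) Skip)"

abbreviation (input) owner :: aexp where "owner \<equiv> Cell OWN (var IV)"
abbreviation (input) steps_done :: aexp where
  "steps_done \<equiv> Sub (Add (Cell LEN owner) (Const 1)) (Cell REM owner)"
abbreviation (input) cell_now :: aexp where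
  "cell_now \<equiv> Add (Cell OFF owner) (Add steps_done steps_done)"

text \<open>If \<open>k\<close> is the index of the next task, \<open>steps_done\<close> is
  \<open>k - 1\<close> and \<open>cell_now\<close> the first of its two output cells. The work
  equals 1 after the decrement exactly if it was 2 before, which is when the machine is
  vacated.\<close>

definition advance_code :: com where
  "advance_code = For IV machine_count
     (Cond (is_zero owner) Skip
       (Seq (Cond (is_one cap_now)
               (Seq (Assign OUT cell_now (var IV)) (Assign OUT (Add cell_now (Const 1)) (var TV)))
               Skip)
            (Cond (Conj (Neg (is_one cap_now)) (Neg (is_one (var IDL)))) Skip
               (Seq (Assign REM owner (Sub (Cell REM owner) (Const 1)))
                    (Cond (is_one (Cell REM owner)) (Assign OWN (var IV) (Const 0)) Skip)))))"

text \<open>The order realises the delay: a unit that expires now must not release successors in the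
  same slot, so starting comes first; a job reduced to 1 now must keep its delay unit for the next
  slot, so advancing comes last.\<close>

definition slot_code :: com where
  "slot_code = Seq start_code (Seq tick_code advance_code)"

definition task_pos :: "sched_instance \<Rightarrow> nat \<Rightarrow> nat \<Rightarrow> nat" where
  "task_pos I j k = (\<Sum>x\<in>{1..<j}. job_len I x) + (k - 1)"

text \<open>The machine cannot multiply, so row addresses of the two tables and output offsets are
  tabulated in advance. These facts concern arrays that a slot never writes.\<close>

definition static :: "sched_instance \<Rightarrow> store \<Rightarrow> bool" where
  "static I s \<longleftrightarrow> s INP 0 = num_machines I \<and> s INP 3 = num_jobs I \<and> s HOR 0 = horizon I \<and>
     (\<forall>j\<in>jobs I. s LEN j = job_len I j \<and> s OFF j = 2 * (\<Sum>x\<in>{1..<j}. job_len I x)) \<and>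
     (\<forall>j\<in>jobs I. \<forall>j'\<in>jobs I. s INP (s PRB j + j') = of_bool (job_prec I j j')) \<and>
     (\<forall>i\<in>machines I. \<forall>t\<in>{1..horizon I}. s INP (s CPB i + t) = capacity I i t)"

section \<open>Frame conditions and verification of the starting phase\<close>

definition same_except :: "nat set \<Rightarrow> store \<Rightarrow> store \<Rightarrow> bool" where
  "same_except X s s' \<longleftrightarrow> (\<forall>x. x \<notin> X \<longrightarrow> s' x = s x)"

lemma same_except_refl [simp]: "same_except X s s"
  by (simp add: same_except_def)

lemma same_except_upd: "same_except X s s' \<Longrightarrow> x \<in> X \<Longrightarrow> same_except X s (s'(x := f))"
  by (auto simp: same_except_def)

lemma same_except_trans:
  "same_except X s s' \<Longrightarrow> same_except Y s' s'' \<Longrightarrow> X \<union> Y \<subseteq> Z \<Longrightarrow> same_except Z s s''"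
  unfolding same_except_def by (metis Un_iff subsetD)

lemma static_same_except:
  assumes "same_except X s s'" "X \<inter> {0, 2, 3, 4, 5, 6} = {}" "static I s"
  shows "static I s'"
proof -
  have "s' x = s x" if "x \<in> {0, 2, 3, 4, 5, 6}" for x
    using assms(1,2) that unfolding same_except_def by blast
  then show ?thesis using assms(3) unfolding static_def by simp
qed

text \<open>Arbitrary \<open>Q\<close> and \<open>b\<close> make this a rule for the nested
  \<open>runs\<close> that \<open>runs_Seq\<close> produces. A round is charged 38 for the body,
  generously rounded, and 12 for the loop.\<close>

lemma ready_code_runs:
  assumes st: "static I s" and j: "s JV 0 = j" "j \<in> jobs I"
    and b: "num_jobs I * 50 + 20 \<le> b"
    and Q: "\<And>s' b'. same_except {RDY, LV} s s' \<Longrightarrow> s' RDY 0 = of_bool (ready I (s REM) j) \<Longrightarrow>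
      b - (num_jobs I * 50 + 20) \<le> b' \<Longrightarrow> Q s' b'"
  shows "runs ready_code s b Q"
proof -
  define P where "P k s' \<longleftrightarrow> same_except {RDY, LV} s s' \<and>
    s' RDY 0 = of_bool (\<forall>l\<in>{1..k}. job_prec I l j \<longrightarrow> s REM l = 0)" for k s'
  let ?s = "s(RDY := (s RDY)(0 := 1))"
  have static: "static I s'" if "P k s'" for k s'
    using static_same_except[OF _ _ st] that unfolding P_def by auto
  have "runs (For LV job_count (Cond (Conj (is_one (Cell INP (Add (Cell PRB (var LV)) (var JV))))
                 (Neg (is_zero (Cell REM (var LV))))) (set_var RDY (Const 0)) Skip)) ?s (b - 3) Q"
  proof (rule For_runs[where P = P and n = "num_jobs I" and b = 38])
    show "P 0 ?s" unfolding P_def by (auto intro: same_except_upd)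
    show "aval job_count s' = num_jobs I" if "P k s'" for k s'
      using static[OF that] unfolding static_def by simp
    show "P k (s'(LV := (s' LV)(0 := v)))" if "P k s'" for k s' v
      using that unfolding P_def by (auto intro: same_except_upd)
  next
    fix k s' assume k: "k < num_jobs I" and P: "P k s'" and v: "s' LV 0 = Suc k"
    have [simp]: "s' JV = s JV" "s' REM = s REM" using P unfolding P_def same_except_def by auto
    have kJ: "Suc k \<in> jobs I" using k unfolding jobs_def by auto
    then have [simp]: "s' INP (s' PRB (Suc k) + j) = of_bool (job_prec I (Suc k) j)"
      using static[OF P] j unfolding static_def by blast
    have "P (Suc k) (s'(RDY := (s' RDY)(0 := 0)))" if "job_prec I (Suc k) j" "s REM (Suc k) \<noteq> 0"
      using P that unfolding P_def by (auto intro: same_except_upd)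
    moreover have "P (Suc k) s'" if "\<not> (job_prec I (Suc k) j \<and> s REM (Suc k) \<noteq> 0)"
      using P that unfolding P_def by (auto simp: atLeastAtMostSuc_conv)
    ultimately show "runs (Cond (Conj (is_one (Cell INP (Add (Cell PRB (var LV)) (var JV))))
        (Neg (is_zero (Cell REM (var LV))))) (set_var RDY (Const 0)) Skip) s' 38
        (\<lambda>s' _. s' LV 0 = Suc k \<and> P (Suc k) s')"
      using v j(1) by auto
  next
    fix s' B' assume "P (num_jobs I) s'" "b - 3 - (num_jobs I * (38 + 12) + 9) \<le> B'"
    then show "Q s' B'" using Q[of s' B'] b unfolding P_def ready_def jobs_def by auto
  qed (use b in auto)
  then show ?thesis using b unfolding ready_code_def by (simp add: numeral_3_eq_3)
qed

text \<open>By \<open>k < i\<close> machine \<open>i\<close> has not been judged yet, so the idle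
  flag keeps its meaning. Jobs started earlier in this slot sit on occupied machines, hence not on
  \<open>i\<close>, and \<open>c' j = 0\<close> shows that \<open>j\<close> is not among
  them.\<close>

lemma starts_assign:
  assumes s: "starts I t k idle r w c w' c'" and i: "i \<in> machines I" "k < i" "w' i = 0"
    and j: "j \<in> jobs I" "c' j = 0" "ready I r j"
  shows "starts I t k idle r w c (w'(i := j)) (c'(j := i))"
proof -
  have M: "i \<noteq> 0" if "i \<in> machines I" for i using that unfolding machines_def by auto
  have J: "j \<noteq> 0" if "j \<in> jobs I" for j using that unfolding jobs_def by auto
  note s' = s[unfolded starts_def]
  have z: "w i = 0" "c j = 0" using s' i j by metis+
  have "(w'(i := j)) i' = w i'" if "i' \<in> machines I" "w i' \<noteq> 0" for i'
    using s' z that by auto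
  moreover have "(c'(j := i)) j' = c j'" if "j' \<in> jobs I" "c j' \<noteq> 0" for j'
    using s' z that by auto
  moreover have "(w'(i := j)) i' \<in> jobs I \<and> c ((w'(i := j)) i') = 0 \<and>
      ready I r ((w'(i := j)) i') \<and> (c'(j := i)) ((w'(i := j)) i') = i'"
    if i': "i' \<in> machines I" "w i' = 0" "(w'(i := j)) i' \<noteq> 0" for i'
  proof (cases "i' = i")
    case False
    then have "w' i' \<in> jobs I \<and> c (w' i') = 0 \<and> ready I r (w' i') \<and> c' (w' i') = i'"
      using s' i' by simp
    moreover from this have "w' i' \<noteq> j" using j(2) M[OF i'(1)] by metis
    ultimately show ?thesis using False by simp
  qed (use z j in simp)
  moreover have "(c'(j := i)) j' \<in> machines I \<and> w ((c'(j := i)) j') = 0 \<and>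
      (w'(i := j)) ((c'(j := i)) j') = j'"
    if j': "j' \<in> jobs I" "c j' = 0" "(c'(j := i)) j' \<noteq> 0" for j'
  proof (cases "j' = j")
    case False
    then have "c' j' \<in> machines I \<and> w (c' j') = 0 \<and> w' (c' j') = j'" using s' j' by simp
    moreover from this have "c' j' \<noteq> i" using i(3) J[OF j'(1)] by metis
    ultimately show ?thesis using False by simp
  qed (use z i in simp)
  moreover have "idle \<longleftrightarrow> (\<exists>i'\<in>{1..k}. (w'(i := j)) i' = 0 \<and> capacity I i' t = 1)"
    using s' i(2) by auto
  moreover have "(c'(j := i)) j' \<noteq> 0" if "idle" "j' \<in> jobs I" "ready I r j'" for j'
    using s' that M[OF i(1)] by auto
  ultimately show ?thesis unfolding starts_def by blast
qed

lemma starts_refl: "starts I t 0 False r w c w c"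
  unfolding starts_def by auto

lemma starts_skip:
  assumes "starts I t k idle r w c w' c'" "\<not> (w' (Suc k) = 0 \<and> capacity I (Suc k) t = 1)"
  shows "starts I t (Suc k) idle r w c w' c'"
proof -
  have "(\<exists>i\<in>{1..Suc k}. w' i = 0 \<and> capacity I i t = 1) \<longleftrightarrow>
      (\<exists>i\<in>{1..k}. w' i = 0 \<and> capacity I i t = 1)"
    using assms(2) by (auto simp: atLeastAtMostSuc_conv)
  then show ?thesis using assms(1) unfolding starts_def by simp
qed

lemma starts_idle:
  assumes "starts I t k idle r w c w' c'" "w' (Suc k) = 0 \<and> capacity I (Suc k) t = 1"
    "\<And>j. j \<in> jobs I \<Longrightarrow> ready I r j \<Longrightarrow> c' j \<noteq> 0"
  shows "starts I t (Suc k) True r w c w' c'"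
proof -
  have "\<exists>i\<in>{1..Suc k}. w' i = 0 \<and> capacity I i t = 1"
    using assms(2) by (intro bexI[of _ "Suc k"]) auto
  then show ?thesis using assms(1,3) unfolding starts_def by simp
qed

lemma pick_code_runs:
  assumes st: "static I s" and i: "s IV 0 = i" "i \<in> machines I" "k < i"
    and w: "starts I t k idle r w c (s OWN) (s MAC)" "r = s REM"
    and b: "num_jobs I * (num_jobs I * 50 + 70) + 20 \<le> b"
    and Q: "\<And>s' b'. same_except {OWN, MAC, RDY, JV, LV} s s' \<Longrightarrow>
      starts I t k idle r w c (s' OWN) (s' MAC) \<Longrightarrow>
      (s' OWN i = 0 \<Longrightarrow> \<forall>j\<in>jobs I. ready I r j \<longrightarrow> s' MAC j \<noteq> 0) \<Longrightarrow>
      b - (num_jobs I * (num_jobs I * 50 + 70) + 20) \<le> b' \<Longrightarrow> Q s' b'"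
  shows "runs pick_code s b Q"
proof -
  \<comment> \<open>The last clause survives a new start because that start makes
    \<open>OWN i\<close> nonzero; at the end it justifies raising the idle flag.\<close>
  define P where "P l s' \<longleftrightarrow> same_except {OWN, MAC, RDY, JV, LV} s s' \<and>
    starts I t k idle r w c (s' OWN) (s' MAC) \<and>
    (s' OWN i = 0 \<longrightarrow> (\<forall>j\<in>{1..l}. ready I r j \<longrightarrow> s' MAC j \<noteq> 0))" for l s'
  have static: "static I s'" if "P l s'" for l s'
    using static_same_except[OF _ _ st] that unfolding P_def by auto
  show ?thesis unfolding pick_code_def
  proof (rule For_runs[where P = P and n = "num_jobs I" and b = "num_jobs I * 50 + 58"])
    show "P 0 s" using w unfolding P_def by simp
    show "aval job_count s' = num_jobs I" if "P l s'" for l s'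
      using static[OF that] unfolding static_def by simp
    show "P l (s'(JV := (s' JV)(0 := v)))" if "P l s'" for l s' v
      using that unfolding P_def by (auto intro: same_except_upd)
  next
    fix l s1 assume l: "l < num_jobs I" and P: "P l s1" and v: "s1 JV 0 = Suc l"
    have s1: "s1 IV = s IV" "s1 REM = s REM" using P unfolding P_def same_except_def by auto
    have lJ: "Suc l \<in> jobs I" using l unfolding jobs_def by auto
    have skip: "P (Suc l) s1" if "s1 OWN i \<noteq> 0 \<or> s1 MAC (Suc l) \<noteq> 0"
      using P that unfolding P_def by (auto simp: atLeastAtMostSuc_conv)
    \<comment> \<open>The guard costs 11, which leaves 47 of the 58.\<close>
    have rdy: "runs ready_code s1 (47 + num_jobs I * 50) (\<lambda>s' b'. runs (Cond (is_one (var RDY))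
          (Seq (Assign OWN (var IV) (var JV)) (Assign MAC (var JV) (var IV))) Skip) s' b'
          (\<lambda>s' _. s' JV 0 = Suc l \<and> P (Suc l) s'))"
      if z: "s1 OWN i = 0" "s1 MAC (Suc l) = 0"
    proof (rule ready_code_runs[OF static[OF P] v lJ])
      fix s2 b' assume s2: "same_except {RDY, LV} s1 s2" "s2 RDY 0 = of_bool (ready I (s1 REM) (Suc l))"
        and b': "47 + num_jobs I * 50 - (num_jobs I * 50 + 20) \<le> b'"
      have e: "s2 IV = s IV" "s2 JV = s1 JV" "s2 OWN = s1 OWN" "s2 MAC = s1 MAC"
        using s1 s2(1) unfolding same_except_def by auto
      have sx: "same_except {OWN, MAC, RDY, JV, LV} s s2"
        using P s2(1) unfolding P_def by (auto intro: same_except_trans)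
      have "P (Suc l) s2" if "\<not> ready I r (Suc l)"
        using P sx e that unfolding P_def by (auto simp: atLeastAtMostSuc_conv)
      moreover have "P (Suc l) (s2(OWN := (s2 OWN)(i := Suc l), MAC := (s2 MAC)(Suc l := i)))"
        if "ready I r (Suc l)"
        using P sx e that z lJ i starts_assign[of I t k idle r w c "s1 OWN" "s1 MAC" i "Suc l"]
        unfolding P_def by (auto intro: same_except_upd)
      ultimately show "runs (Cond (is_one (var RDY))
          (Seq (Assign OWN (var IV) (var JV)) (Assign MAC (var JV) (var IV))) Skip) s2 b'
          (\<lambda>s' _. s' JV 0 = Suc l \<and> P (Suc l) s')"
        using b' s2(2) v e i(1) w(2) s1 by auto
    qed auto
    show "runs (Cond (Conj (is_zero (Cell OWN (var IV))) (is_zero (Cell MAC (var JV))))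
        (Seq ready_code (Cond (is_one (var RDY))
          (Seq (Assign OWN (var IV) (var JV)) (Assign MAC (var JV) (var IV))) Skip))
        Skip) s1 (num_jobs I * 50 + 58) (\<lambda>s' _. s' JV 0 = Suc l \<and> P (Suc l) s')"
    proof (cases "s1 OWN i = 0 \<and> s1 MAC (Suc l) = 0")
      case True
      then show ?thesis using rdy s1 v i(1) by simp
    next
      case False
      then show ?thesis using skip s1 v i(1) by auto
    qed
  next
    fix s' B' assume "P (num_jobs I) s'"
      "b - (num_jobs I * (num_jobs I * 50 + 58 + 12) + 9) \<le> B'"
    then show "Q s' B'" using Q[of s' B'] b unfolding P_def jobs_def by (auto simp: algebra_simps)
  qed (use b in \<open>auto simp: algebra_simps\<close>)
qed

lemma start_code_runs:
  assumes st: "static I s" and t: "s TV 0 = t" "t \<in> {1..horizon I}"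
    and b: "num_machines I * (num_jobs I * (num_jobs I * 50 + 70) + 70) + 20 \<le> b"
    and Q: "\<And>s' b'. same_except {OWN, MAC, IDL, RDY, IV, JV, LV} s s' \<Longrightarrow>
      starts I t (num_machines I) (s' IDL 0 = 1) (s REM) (s OWN) (s MAC) (s' OWN) (s' MAC) \<Longrightarrow>
      b - (num_machines I * (num_jobs I * (num_jobs I * 50 + 70) + 70) + 20) \<le> b' \<Longrightarrow> Q s' b'"
  shows "runs start_code s b Q"
proof -
  let ?s = "s(IDL := (s IDL)(0 := 0))"
  let ?p = "num_jobs I * (num_jobs I * 50 + 70)"
  define P where "P k s' \<longleftrightarrow> same_except {OWN, MAC, IDL, RDY, IV, JV, LV} s s' \<and>
    starts I t k (s' IDL 0 = 1) (s REM) (s OWN) (s MAC) (s' OWN) (s' MAC)" for k s'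
  have static: "static I s'" if "P l s'" for l s'
    using static_same_except[OF _ _ st] that unfolding P_def by auto
  have "runs (For IV machine_count
     (Cond (Conj (is_zero (Cell OWN (var IV))) (is_one cap_now))
       (Seq pick_code (Cond (is_zero (Cell OWN (var IV))) (set_var IDL (Const 1)) Skip))
       Skip)) ?s (b - 3) Q"
  proof (rule For_runs[where P = P and n = "num_machines I" and b = "?p + 58"])
    show "P 0 ?s" using starts_refl unfolding P_def by (auto intro: same_except_upd)
    show "aval machine_count s' = num_machines I" if "P l s'" for l s'
      using static[OF that] unfolding static_def by simp
    show "P l (s'(IV := (s' IV)(0 := v)))" if "P l s'" for l s' v
      using that unfolding P_def by (auto intro: same_except_upd)
  next
    fix k s1 assume k: "k < num_machines I" and P: "P k s1" and v: "s1 IV 0 = Suc k"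
    have s1: "s1 TV = s TV" "s1 REM = s REM" using P unfolding P_def same_except_def by auto
    have kM: "Suc k \<in> machines I" using k unfolding machines_def by auto
    have cap: "s1 INP (s1 CPB (Suc k) + t) = capacity I (Suc k) t"
      using static[OF P] kM t(2) unfolding static_def by blast
    have skip: "P (Suc k) s1" if "\<not> (s1 OWN (Suc k) = 0 \<and> capacity I (Suc k) t = 1)"
      using P starts_skip that unfolding P_def by blast
    have pick: "runs pick_code s1 (43 + ?p) (\<lambda>s' b'. runs
        (Cond (is_zero (Cell OWN (var IV))) (set_var IDL (Const 1)) Skip) s' b'
        (\<lambda>s' _. s' IV 0 = Suc k \<and> P (Suc k) s'))"
      if z: "s1 OWN (Suc k) = 0" "capacity I (Suc k) t = 1"
    proof (rule pick_code_runs[OF static[OF P] v kM])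
      show "starts I t k (s1 IDL 0 = 1) (s REM) (s OWN) (s MAC) (s1 OWN) (s1 MAC)"
        using P unfolding P_def by blast
      show "s REM = s1 REM" using s1 by simp
    next
      fix s2 b' assume s2: "same_except {OWN, MAC, RDY, JV, LV} s1 s2"
        "starts I t k (s1 IDL 0 = 1) (s REM) (s OWN) (s MAC) (s2 OWN) (s2 MAC)"
        "s2 OWN (Suc k) = 0 \<Longrightarrow> \<forall>j\<in>jobs I. ready I (s REM) j \<longrightarrow> s2 MAC j \<noteq> 0"
        and b': "43 + ?p - (?p + 20) \<le> b'"
      have e: "s2 IV = s1 IV" "s2 IDL = s1 IDL" using s2(1) unfolding same_except_def by auto
      have sx: "same_except {OWN, MAC, IDL, RDY, IV, JV, LV} s s2"
        using P s2(1) unfolding P_def by (auto intro: same_except_trans)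
      have "P (Suc k) s2" if "s2 OWN (Suc k) \<noteq> 0"
        using starts_skip[OF s2(2)] sx e that unfolding P_def by auto
      moreover have "P (Suc k) (s2(IDL := (s2 IDL)(0 := 1)))" if "s2 OWN (Suc k) = 0"
        using starts_idle[OF s2(2)] s2(3) sx that z unfolding P_def by (auto intro: same_except_upd)
      ultimately show "runs (Cond (is_zero (Cell OWN (var IV))) (set_var IDL (Const 1)) Skip) s2 b'
        (\<lambda>s' _. s' IV 0 = Suc k \<and> P (Suc k) s')"
        using b' v e by auto
    qed auto
    show "runs (Cond (Conj (is_zero (Cell OWN (var IV))) (is_one cap_now))
       (Seq pick_code (Cond (is_zero (Cell OWN (var IV))) (set_var IDL (Const 1)) Skip))
       Skip) s1 (?p + 58) (\<lambda>s' _. s' IV 0 = Suc k \<and> P (Suc k) s')"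
    proof (cases "s1 OWN (Suc k) = 0 \<and> capacity I (Suc k) t = 1")
      case True
      then show ?thesis using pick s1 v t(1) cap by simp
    next
      case False
      then show ?thesis using skip s1 v t(1) cap by auto
    qed
  next
    fix s' B' assume "P (num_machines I) s'"
      "b - 3 - (num_machines I * (?p + 58 + 12) + 9) \<le> B'"
    then show "Q s' B'" using Q[of s' B'] b unfolding P_def by (auto simp: algebra_simps)
  qed (use b in \<open>auto simp: algebra_simps\<close>)
  then show ?thesis using b unfolding start_code_def by (simp add: numeral_3_eq_3)
qed

lemma tick_code_runs:
  assumes st: "static I s" and b: "num_jobs I * 40 + 20 \<le> b"
    and Q: "\<And>s' b'. same_except {REM, JV} s s' \<Longrightarrow>
      (\<And>j. j \<in> jobs I \<Longrightarrow> s' REM j = (if s REM j = 1 then 0 else s REM j)) \<Longrightarrow>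
      b - (num_jobs I * 40 + 20) \<le> b' \<Longrightarrow> Q s' b'"
  shows "runs tick_code s b Q"
proof -
  define P where "P k s' \<longleftrightarrow> same_except {REM, JV} s s' \<and>
    (\<forall>j. s' REM j = (if j \<in> {1..k} \<and> s REM j = 1 then 0 else s REM j))" for k s'
  have static: "static I s'" if "P l s'" for l s'
    using static_same_except[OF _ _ st] that unfolding P_def by auto
  show ?thesis unfolding tick_code_def
  proof (rule For_runs[where P = P and n = "num_jobs I" and b = 28])
    show "P 0 s" unfolding P_def by simp
    show "aval job_count s' = num_jobs I" if "P l s'" for l s'
      using static[OF that] unfolding static_def by simp
    show "P l (s'(JV := (s' JV)(0 := v)))" if "P l s'" for l s' v
      using that unfolding P_def by (auto intro: same_except_upd)
  next
    fix k s1 assume k: "k < num_jobs I" and P: "P k s1" and v: "s1 JV 0 = Suc k"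
    have "P (Suc k) s1" if "s1 REM (Suc k) \<noteq> 1"
      using P that unfolding P_def by (auto simp: le_Suc_eq)
    moreover have "P (Suc k) (s1(REM := (s1 REM)(Suc k := 0)))" if "s1 REM (Suc k) = 1"
      using P that unfolding P_def by (auto intro: same_except_upd simp: le_Suc_eq)
    ultimately show "runs (Cond (is_one (Cell REM (var JV))) (Assign REM (var JV) (Const 0)) Skip)
        s1 28 (\<lambda>s' _. s' JV 0 = Suc k \<and> P (Suc k) s')"
      using v by auto
  next
    fix s' B' assume "P (num_jobs I) s'" "b - (num_jobs I * (28 + 12) + 9) \<le> B'"
    then show "Q s' B'" using Q[of s' B'] b unfolding P_def jobs_def by auto
  qed (use b in auto)
qed

section \<open>Decoding of the store and verification of the advancing phase\<close>

definition placement :: "sched_instance \<Rightarrow> store \<Rightarrow> nat \<times> nat \<Rightarrow> nat \<times> nat" where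
  "placement I s = (\<lambda>(j, k). (s OUT (2 * task_pos I j k), s OUT (2 * task_pos I j k + 1)))"

text \<open>The abstraction map through which the program is compared with the relation
  \<open>slot\<close>.\<close>

definition read_state :: "sched_instance \<Rightarrow> store \<Rightarrow> state" where
  "read_state I s = \<lparr>rem = s REM, mac = s MAC, own = s OWN, out = placement I s\<rparr>"

lemma read_state_simps [simp]:
  "rem (read_state I s) = s REM" "mac (read_state I s) = s MAC" "own (read_state I s) = s OWN"
  "out (read_state I s) = placement I s"
  by (simp_all add: read_state_def)

lemma task_pos_less:
  assumes "j < j'" "j \<in> jobs I" "k \<in> {1..job_len I j}"
  shows "task_pos I j k < task_pos I j' k'"
proof -
  have "{1..<Suc j} \<subseteq> {1..<j'}" using assms(1) by auto
  then have "(\<Sum>x\<in>{1..<Suc j}. job_len I x) \<le> (\<Sum>x\<in>{1..<j'}. job_len I x)"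
    by (intro sum_mono2) auto
  moreover have "(\<Sum>x\<in>{1..<Suc j}. job_len I x) = (\<Sum>x\<in>{1..<j}. job_len I x) + job_len I j"
    using assms(2) unfolding jobs_def by (subst sum.atLeastLessThan_Suc) auto
  ultimately show ?thesis using assms(3) unfolding task_pos_def by auto
qed

text \<open>Hence the output cells of different tasks are disjoint, and entering one task leaves all
  other entries intact.\<close>

lemma task_pos_eq_iff:
  assumes "j \<in> jobs I" "k \<in> {1..job_len I j}" "j' \<in> jobs I" "k' \<in> {1..job_len I j'}"
  shows "task_pos I j k = task_pos I j' k' \<longleftrightarrow> j = j' \<and> k = k'"
proof (cases j j' rule: linorder_cases)
  case less
  then show ?thesis using task_pos_less[OF less assms(1,2), of k'] by auto
next
  case greater
  then show ?thesis using task_pos_less[OF greater assms(3,4), of k] by auto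
next
  case equal
  then show ?thesis using assms unfolding task_pos_def by auto
qed

text \<open>The loop changes \<open>OWN\<close> and \<open>REM\<close> while its effect is described
  by their initial values. This is sound because \<open>own\<close> ties occupants and machines one
  to one, so a round touches only the occupant of its own machine. Jobs already treated are those
  with \<open>c j \<le> l\<close>.\<close>

lemma advance_code_runs:
  fixes s :: store
  defines "w \<equiv> s OWN" and "c \<equiv> s MAC" and "r \<equiv> s REM" and "idle \<equiv> s IDL 0 = 1"
  assumes st: "static I s" and t: "s TV 0 = t" "t \<in> {1..horizon I}"
    and own: "\<And>i. i \<in> machines I \<Longrightarrow> w i \<noteq> 0 \<Longrightarrow>
      w i \<in> jobs I \<and> c (w i) = i \<and> 2 \<le> r (w i) \<and> r (w i) \<le> job_len I (w i) + 1"
    and b: "num_machines I * 150 + 20 \<le> b"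
    and Q: "\<And>s' b'. same_except {OUT, REM, OWN, IV} s s' \<Longrightarrow>
      (\<And>j. j \<in> jobs I \<Longrightarrow> s' REM j = (if advancing I t idle w c j then r j - 1 else r j)) \<Longrightarrow>
      (\<And>i. i \<in> machines I \<Longrightarrow> s' OWN i =
         (if (capacity I i t = 1 \<or> idle) \<and> r (w i) = 2 then 0 else w i)) \<Longrightarrow>
      (\<And>j k. j \<in> jobs I \<Longrightarrow> k \<in> {1..job_len I j} \<Longrightarrow> placement I s' (j, k) =
        (if advancing I t idle w c j \<and> capacity I (c j) t = 1 \<and> k + r j = job_len I j + 2
         then (c j, t) else placement I s (j, k))) \<Longrightarrow>
      b - (num_machines I * 150 + 20) \<le> b' \<Longrightarrow> Q s' b'"
  shows "runs advance_code s b Q"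
proof -
  define adv where "adv = advancing I t idle w c"
  define P where "P l s' \<longleftrightarrow> same_except {OUT, REM, OWN, IV} s s' \<and>
      (\<forall>j\<in>jobs I. s' REM j = (if adv j \<and> c j \<le> l then r j - 1 else r j)) \<and>
      (\<forall>i\<in>machines I. s' OWN i =
         (if i \<le> l \<and> (capacity I i t = 1 \<or> idle) \<and> r (w i) = 2 then 0 else w i)) \<and>
      (\<forall>j\<in>jobs I. \<forall>k\<in>{1..job_len I j}. placement I s' (j, k) =
        (if adv j \<and> c j \<le> l \<and> capacity I (c j) t = 1 \<and> k + r j = job_len I j + 2
         then (c j, t) else placement I s (j, k)))" for l s'
  have M: "i \<noteq> 0" if "i \<in> machines I" for i using that unfolding machines_def by auto
  have J: "j \<noteq> 0" if "j \<in> jobs I" for j using that unfolding jobs_def by auto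
  have static: "static I s'" if "P l s'" for l s'
    using static_same_except[OF _ _ st] that unfolding P_def by auto
  have advM: "c j \<in> machines I" "w (c j) = j" "c j \<noteq> 0" if "adv j" for j
    using that M unfolding adv_def advancing_def by auto
  show ?thesis unfolding advance_code_def
  proof (rule For_runs[where P = P and n = "num_machines I" and b = 138])
    show "P 0 s" unfolding P_def w_def[symmetric] r_def[symmetric] by (auto dest: advM(3) M)
    show "aval machine_count s' = num_machines I" if "P l s'" for l s'
      using static[OF that] unfolding static_def by simp
    show "P l (s'(IV := (s' IV)(0 := v)))" if "P l s'" for l s' v
      using that unfolding P_def placement_def by (auto intro: same_except_upd)
  next
    fix l s1 assume l: "l < num_machines I" and P: "P l s1" and v: "s1 IV 0 = Suc l"
    define i where "i = Suc l"
    define j where "j = w i"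
    have iM: "i \<in> machines I" using l unfolding i_def machines_def by auto
    have s1: "s1 TV = s TV" "s1 IDL = s IDL" using P unfolding P_def same_except_def by auto
    have cap: "s1 INP (s1 CPB i + t) = capacity I i t"
      using static[OF P] iM t(2) unfolding static_def by blast
    have si: "s1 OWN i = j" using P iM unfolding P_def i_def j_def by simp
    have other: "adv j' \<and> c j' \<le> i \<longleftrightarrow> adv j' \<and> c j' \<le> l" if "j' \<noteq> j" for j'
      using advM(2)[of j'] that unfolding i_def j_def by (auto simp: le_Suc_eq)
    have othi: "i' \<le> i \<longleftrightarrow> i' \<le> l" if "i' \<noteq> i" for i' using that unfolding i_def by auto
    show "runs (Cond (is_zero owner) Skip
       (Seq (Cond (is_one cap_now)
               (Seq (Assign OUT cell_now (var IV)) (Assign OUT (Add cell_now (Const 1)) (var TV)))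
               Skip)
            (Cond (Conj (Neg (is_one cap_now)) (Neg (is_one (var IDL)))) Skip
               (Seq (Assign REM owner (Sub (Cell REM owner) (Const 1)))
                    (Cond (is_one (Cell REM owner)) (Assign OWN (var IV) (Const 0)) Skip)))))
       s1 138 (\<lambda>s' _. s' IV 0 = Suc l \<and> P (Suc l) s')"
    proof (cases "j = 0")
      case True
      have "P i s1" unfolding P_def
      proof (intro conjI ballI)
        fix j' assume j': "j' \<in> jobs I"
        then have "j' \<noteq> j" using True J by blast
        from other[OF this] show "s1 REM j' = (if adv j' \<and> c j' \<le> i then r j' - 1 else r j')"
          using P j' unfolding P_def by simp
      next
        fix i' assume "i' \<in> machines I"
        then show "s1 OWN i' =
         (if i' \<le> i \<and> (capacity I i' t = 1 \<or> idle) \<and> r (w i') = 2 then 0 else w i')"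
          using P si True othi[of i'] unfolding P_def j_def by (cases "i' = i") auto
      next
        fix j' k assume j': "j' \<in> jobs I" "k \<in> {1..job_len I j'}"
        then have "j' \<noteq> j" using True J by blast
        from other[OF this] show "placement I s1 (j', k) =
          (if adv j' \<and> c j' \<le> i \<and> capacity I (c j') t = 1 \<and> k + r j' = job_len I j' + 2
          then (c j', t) else placement I s (j', k))"
          using P j' unfolding P_def by auto
      qed (use P in \<open>simp add: P_def\<close>)
      then show ?thesis using True si v unfolding i_def by simp
    next
      case False
      then have j: "j \<in> jobs I" "c j = i" "2 \<le> r j" "r j \<le> job_len I j + 1"
        using own[OF iM] unfolding j_def by auto
      have rj: "s1 REM j = r j" using P j unfolding P_def i_def by simp
      have advj: "adv j \<longleftrightarrow> capacity I i t = 1 \<or> idle"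
        using j iM unfolding adv_def advancing_def j_def by simp
      define k where "k = job_len I j + 2 - r j"
      have k: "k \<in> {1..job_len I j}" "k + r j = job_len I j + 2" using j unfolding k_def by auto
      have "s1 LEN j = job_len I j" "s1 OFF j = 2 * (\<Sum>x\<in>{1..<j}. job_len I x)"
        using static[OF P] j(1) unfolding static_def by blast+
      then have pos: "s1 OFF j + (s1 LEN j + 1 - r j + (s1 LEN j + 1 - r j)) = 2 * task_pos I j k"
        unfolding task_pos_def k_def using j by auto
      define o2 where "o2 = (if capacity I i t = 1
        then (s1 OUT)(2 * task_pos I j k := i, 2 * task_pos I j k + 1 := t) else s1 OUT)"
      define s2 where "s2 = s1(OUT := o2)"
      define r3 where "r3 = (if adv j then (s1 REM)(j := r j - 1) else s1 REM)"
      define w3 where "w3 = (if adv j \<and> r j = 2 then (s1 OWN)(i := 0) else s1 OWN)"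
      define s3 where "s3 = s2(REM := r3, OWN := w3)"
      have "P i s3" unfolding P_def
      proof (intro conjI ballI)
        show "same_except {OUT, REM, OWN, IV} s s3"
          using P unfolding P_def s3_def s2_def by (auto intro: same_except_upd)
      next
        fix j' assume j': "j' \<in> jobs I"
        then show "s3 REM j' = (if adv j' \<and> c j' \<le> i then r j' - 1 else r j')"
          using P rj j other[of j'] unfolding P_def s3_def r3_def by (cases "j' = j") auto
      next
        fix i' assume i': "i' \<in> machines I"
        then show "s3 OWN i' =
         (if i' \<le> i \<and> (capacity I i' t = 1 \<or> idle) \<and> r (w i') = 2 then 0 else w i')"
          using P si othi[of i'] advj unfolding P_def s3_def w3_def
          by (cases "i' = i") (auto simp: j_def)
      next
        fix j' k' assume j': "j' \<in> jobs I" "k' \<in> {1..job_len I j'}"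
        have o1: "placement I s1 (j', k') =
          (if adv j' \<and> c j' \<le> l \<and> capacity I (c j') t = 1 \<and> k' + r j' = job_len I j' + 2
          then (c j', t) else placement I s (j', k'))"
          using P j' unfolding P_def by simp
        show "placement I s3 (j', k') =
          (if adv j' \<and> c j' \<le> i \<and> capacity I (c j') t = 1 \<and> k' + r j' = job_len I j' + 2
          then (c j', t) else placement I s (j', k'))"
        proof (cases "j' = j \<and> k' = k")
          case True
          then show ?thesis
            using o1 k j advj unfolding s3_def s2_def o2_def placement_def i_def by auto
        next
          case False
          then have ne: "task_pos I j' k' \<noteq> task_pos I j k"
            using task_pos_eq_iff[OF j' j(1) k(1)] by simp
          \<comment> \<open>Machines are stored in even cells and slots in odd ones.\<close>
          then have "2 * task_pos I j' k' \<noteq> Suc (2 * task_pos I j k)"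
            "Suc (2 * task_pos I j' k') \<noteq> 2 * task_pos I j k" by presburger+
          then have "placement I s3 (j', k') = placement I s1 (j', k')"
            using ne unfolding s3_def s2_def o2_def placement_def by auto
          then show ?thesis using o1 other[of j'] False k(2) by (cases "j' = j") auto
        qed
      qed
      let ?c1 = "Cond (is_one cap_now)
        (Seq (Assign OUT cell_now (var IV)) (Assign OUT (Add cell_now (Const 1)) (var TV))) Skip"
      let ?c2 = "Cond (Conj (Neg (is_one cap_now)) (Neg (is_one (var IDL)))) Skip
        (Seq (Assign REM owner (Sub (Cell REM owner) (Const 1)))
          (Cond (is_one (Cell REM owner)) (Assign OWN (var IV) (Const 0)) Skip))"
      \<comment> \<open>The guard costs 5 of the 138. Describing the store after each conditional in
        closed form keeps the case distinctions from multiplying.\<close>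
      have c1: "runs ?c1 s1 133 (\<lambda>s' b'. s' = s2 \<and> 60 \<le> b')"
        using v si cap s1 t(1) pos rj unfolding s2_def o2_def i_def[symmetric] by auto
      have c2: "runs ?c2 s2 60 (\<lambda>s' _. s' = s3)"
        using v si cap s1 t(1) rj advj j
        unfolding s3_def s2_def r3_def w3_def i_def[symmetric] idle_def by auto
      have "runs (Seq ?c1 ?c2) s1 133 (\<lambda>s' _. s' = s3)"
        by (rule runs_SeqI[OF c1]) (use c2 in blast)
      moreover have "s3 IV 0 = Suc l" using v unfolding s3_def s2_def by simp
      ultimately have "runs (Seq ?c1 ?c2) s1 133 (\<lambda>s' _. s' IV 0 = Suc l \<and> P (Suc l) s')"
        using \<open>P i s3\<close> unfolding i_def by (auto elim!: runs_mono simp del: runs_Seq)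
      then show ?thesis using False si v unfolding i_def by (subst runs_Cond) (simp del: runs_Seq)
    qed
  next
    fix s' B' assume "P (num_machines I) s'" and B: "b - (num_machines I * (138 + 12) + 9) \<le> B'"
    then have P: "same_except {OUT, REM, OWN, IV} s s'"
      "\<And>j. j \<in> jobs I \<Longrightarrow> s' REM j = (if adv j \<and> c j \<le> num_machines I then r j - 1 else r j)"
      "\<And>i. i \<in> machines I \<Longrightarrow> s' OWN i =
         (if i \<le> num_machines I \<and> (capacity I i t = 1 \<or> idle) \<and> r (w i) = 2 then 0 else w i)"
      "\<And>j k. j \<in> jobs I \<Longrightarrow> k \<in> {1..job_len I j} \<Longrightarrow> placement I s' (j, k) =
        (if adv j \<and> c j \<le> num_machines I \<and> capacity I (c j) t = 1 \<and> k + r j = job_len I j + 2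
         then (c j, t) else placement I s (j, k))"
      unfolding P_def by blast+
    have le: "i \<le> num_machines I" if "i \<in> machines I" for i using that unfolding machines_def by auto
    show "Q s' B'"
      by (rule Q[OF P(1)]) (use P(2-4) advM(1) le b B in \<open>auto simp: adv_def[symmetric]\<close>)
  qed (use b in auto)
qed

text \<open>Polymorphic, so that one expression serves both as a number of steps and, at the
  monomial, as a polynomial.\<close>

definition slot_cost :: "'a::comm_semiring_1 \<Rightarrow> 'a" where
  "slot_cost x = (x * (x * (x * 50 + 70) + 70) + 20) + (x * 40 + 20) + (x * 150 + 20)"

text \<open>\<open>slot\<close> treats expiring delay units and advancing occupants simultaneously,
  the program in succession. Both agree because an occupant has work at least 2 and so is untouched
  by \<open>tick_code\<close>.\<close>

lemma slot_code_runs: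
  assumes v: "valid_instance I" and st: "static I s" and t: "s TV 0 = t" "t \<in> {1..horizon I}"
    and c: "consistent I t (read_state I s)"
    and x: "num_machines I \<le> x" "num_jobs I \<le> x"
  shows "runs slot_code s (slot_cost x) (\<lambda>s' _.
    same_except {OUT, REM, MAC, OWN, IDL, RDY, IV, JV, LV} s s' \<and>
    slot I t (s' IDL 0 = 1) (read_state I s) (read_state I s'))"
proof -
  let ?Q = "\<lambda>s'. same_except {OUT, REM, MAC, OWN, IDL, RDY, IV, JV, LV} s s' \<and>
    slot I t (s' IDL 0 = 1) (read_state I s) (read_state I s')"
  have m: "num_machines I * (num_jobs I * (num_jobs I * 50 + 70) + 70) + 20 \<le>
      x * (x * (x * 50 + 70) + 70) + 20"
    using x by (intro add_mono mult_le_mono order_refl)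
  have n: "num_jobs I * 40 + 20 \<le> x * 40 + 20" "num_machines I * 150 + 20 \<le> x * 150 + 20"
    using x by auto
  show ?thesis unfolding slot_code_def runs_Seq
  proof (rule start_code_runs[OF st t])
    fix s1 b1 assume s1: "same_except {OWN, MAC, IDL, RDY, IV, JV, LV} s s1"
      "starts I t (num_machines I) (s1 IDL 0 = 1) (s REM) (s OWN) (s MAC) (s1 OWN) (s1 MAC)"
      and b1: "slot_cost x - (num_machines I * (num_jobs I * (num_jobs I * 50 + 70) + 70) + 20) \<le> b1"
    have e1: "s1 REM = s REM" "s1 OUT = s OUT" "s1 TV = s TV"
      using s1(1) unfolding same_except_def by auto
    have b1': "(x * 40 + 20) + (x * 150 + 20) \<le> b1" using m b1 unfolding slot_cost_def by linarith
    have l: "linked I (s REM) (s1 OWN) (s1 MAC)"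
      using starts_linked[OF v _ s1(2)] c unfolding consistent_def by simp
    have st1: "static I s1" using static_same_except[OF s1(1) _ st] by auto
    show "runs tick_code s1 b1 (\<lambda>s' b'. runs advance_code s' b' (\<lambda>s' _. ?Q s'))"
    proof (rule tick_code_runs[OF st1])
      fix s2 b2 assume s2: "same_except {REM, JV} s1 s2"
        "\<And>j. j \<in> jobs I \<Longrightarrow> s2 REM j = (if s1 REM j = 1 then 0 else s1 REM j)"
        and b2: "b1 - (num_jobs I * 40 + 20) \<le> b2"
      have e2: "s2 OWN = s1 OWN" "s2 MAC = s1 MAC" "s2 IDL = s1 IDL" "s2 OUT = s1 OUT" "s2 TV = s1 TV"
        using s2(1) unfolding same_except_def by auto
      have st2: "static I s2" using static_same_except[OF s2(1) _ st1] by auto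
      have own: "s1 OWN i \<in> jobs I \<and> s1 MAC (s1 OWN i) = i \<and> 2 \<le> s REM (s1 OWN i) \<and>
          s REM (s1 OWN i) \<le> job_len I (s1 OWN i) + 1 \<and> s2 REM (s1 OWN i) = s REM (s1 OWN i)"
        if "i \<in> machines I" "s1 OWN i \<noteq> 0" for i
      proof -
        have *: "s1 OWN i \<in> jobs I \<and> s1 MAC (s1 OWN i) = i \<and> 2 \<le> s REM (s1 OWN i)"
          using l that unfolding linked_def by blast
        moreover from * have "s REM (s1 OWN i) \<le> job_len I (s1 OWN i) + 1"
          using l unfolding linked_def by blast
        moreover from * have "s2 REM (s1 OWN i) = s REM (s1 OWN i)" using s2(2) e1 by simp
        ultimately show ?thesis by blast
      qed
      show "runs advance_code s2 b2 (\<lambda>s' _. ?Q s')"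
      proof (rule advance_code_runs[OF st2])
        show "s2 TV 0 = t" "t \<in> {1..horizon I}" using e1 e2 t by auto
        show "s2 OWN i \<in> jobs I \<and> s2 MAC (s2 OWN i) = i \<and> 2 \<le> s2 REM (s2 OWN i) \<and>
          s2 REM (s2 OWN i) \<le> job_len I (s2 OWN i) + 1"
          if "i \<in> machines I" "s2 OWN i \<noteq> 0" for i
          using own[of i] that e2 by simp
        show "num_machines I * 150 + 20 \<le> b2" using b1' b2 n by linarith
      next
        fix s3 b3
        let ?adv = "advancing I t (s2 IDL 0 = 1) (s2 OWN) (s2 MAC)"
        assume s3: "same_except {OUT, REM, OWN, IV} s2 s3"
          and r: "\<And>j. j \<in> jobs I \<Longrightarrow> s3 REM j = (if ?adv j then s2 REM j - 1 else s2 REM j)"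
          and w: "\<And>i. i \<in> machines I \<Longrightarrow> s3 OWN i =
            (if (capacity I i t = 1 \<or> s2 IDL 0 = 1) \<and> s2 REM (s2 OWN i) = 2 then 0 else s2 OWN i)"
          and o: "\<And>j k. j \<in> jobs I \<Longrightarrow> k \<in> {1..job_len I j} \<Longrightarrow> placement I s3 (j, k) =
            (if ?adv j \<and> capacity I (s2 MAC j) t = 1 \<and> k + s2 REM j = job_len I j + 2
             then (s2 MAC j, t) else placement I s2 (j, k))"
        have e3: "s3 MAC = s1 MAC" "s3 IDL = s1 IDL" "s2 IDL = s1 IDL" "s2 OWN = s1 OWN" "s2 MAC = s1 MAC"
          using s3 e2 unfolding same_except_def by auto
        have adv: "s2 REM j = s REM j \<and> 2 \<le> s REM j" if "?adv j" "j \<in> jobs I" for j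
          using that own[of "s2 MAC j"] e2 unfolding advancing_def jobs_def by auto
        have "same_except {OUT, REM, MAC, OWN, IDL, RDY, IV, JV, LV} s1 s3"
          by (rule same_except_trans[OF s2(1) s3]) auto
        then have "same_except {OUT, REM, MAC, OWN, IDL, RDY, IV, JV, LV} s s3"
          by (rule same_except_trans[OF s1(1)]) auto
        moreover have "s3 REM j = (if ?adv j then s REM j - 1 else if s REM j = 1 then 0 else s REM j)"
          if "j \<in> jobs I" for j
          using r[OF that] s2(2)[OF that] adv[of j] that e1 by auto
        moreover have "s3 OWN i =
            (if (capacity I i t = 1 \<or> s1 IDL 0 = 1) \<and> s REM (s1 OWN i) = 2 then 0 else s1 OWN i)"
          if "i \<in> machines I" for i
          using w[OF that] own[OF that] e3 by (cases "s1 OWN i = 0") auto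
        moreover have "placement I s3 (j, k) =
            (if ?adv j \<and> capacity I (s1 MAC j) t = 1 \<and> k + s REM j = job_len I j + 2
             then (s1 MAC j, t) else placement I s (j, k))"
          if "j \<in> jobs I" "k \<in> {1..job_len I j}" for j k
          using o[OF that] adv[of j] that e1 e2 unfolding placement_def by auto
        ultimately show "?Q s3"
          using s1(2) unfolding slot_def e3 read_state_simps by blast
      qed
    qed (use b1' n in linarith)
  qed (use m in \<open>simp add: slot_cost_def\<close>)
qed

section \<open>The sweep over all slots\<close>

definition sweep_code :: com where
  "sweep_code = For TV (var HOR) slot_code"

lemma sweep_code_runs:
  assumes v: "valid_instance I" and st: "static I s" and i: "initial I (read_state I s)"
    and x: "num_machines I \<le> x" "num_jobs I \<le> x" "horizon I \<le> x"
  shows "runs sweep_code s (x * (slot_cost x + 12) + 9)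
    (\<lambda>s' _. \<exists>st idle. greedy_run I st idle \<and> st (Suc (horizon I)) = read_state I s')"
proof -
  \<comment> \<open>The store keeps no history, so the invariant carries the whole run so far as an
    existentially quantified trace, extended by one state per round.\<close>
  define P where "P k s' \<longleftrightarrow> static I s' \<and> consistent I (Suc k) (read_state I s') \<and>
    (\<exists>st idle. initial I (st 1) \<and> st (Suc k) = read_state I s' \<and>
      (\<forall>t\<in>{1..k}. slot I t (idle t) (st t) (st (Suc t))))" for k s'
  show ?thesis unfolding sweep_code_def
  proof (rule For_runs[where P = P and n = "horizon I" and b = "slot_cost x"])
    show "P 0 s" unfolding P_def using st i initial_consistent[OF i]
      by (auto intro!: exI[of _ "\<lambda>_. read_state I s"])
    show "aval (var HOR) s' = horizon I" if "P k s'" for k s'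
      using that unfolding P_def static_def by simp
    show "P k (s'(TV := (s' TV)(0 := u)))" if "P k s'" for k s' u
    proof -
      have "read_state I (s'(TV := (s' TV)(0 := u))) = read_state I s'"
        unfolding read_state_def placement_def by simp
      then show ?thesis using that unfolding P_def static_def by simp
    qed
  next
    fix k s1 assume k: "k < horizon I" and P: "P k s1" and tv: "s1 TV 0 = Suc k"
    have t: "Suc k \<in> {1..horizon I}" using k by simp
    have c: "static I s1" "consistent I (Suc k) (read_state I s1)" using P unfolding P_def by auto
    show "runs slot_code s1 (slot_cost x) (\<lambda>s' _. s' TV 0 = Suc k \<and> P (Suc k) s')"
    proof (rule runs_mono[OF slot_code_runs[OF v c(1) tv t c(2) x(1,2)] order_refl])
      fix s2 assume s2: "same_except {OUT, REM, MAC, OWN, IDL, RDY, IV, JV, LV} s1 s2 \<and>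
        slot I (Suc k) (s2 IDL 0 = 1) (read_state I s1) (read_state I s2)"
      obtain st idle where r: "initial I (st 1)" "st (Suc k) = read_state I s1"
        "\<forall>t\<in>{1..k}. slot I t (idle t) (st t) (st (Suc t))" using P unfolding P_def by blast
      define st' where "st' = st(Suc (Suc k) := read_state I s2)"
      define idle' where "idle' = idle(Suc k := (s2 IDL 0 = 1))"
      have "slot I t (idle' t) (st' t) (st' (Suc t))" if "t \<in> {1..Suc k}" for t
        using that r s2 unfolding st'_def idle'_def by (cases "t = Suc k") auto
      moreover have "initial I (st' 1)" "st' (Suc (Suc k)) = read_state I s2"
        using r unfolding st'_def by auto
      moreover have "static I s2"
        by (rule static_same_except[OF conjunct1[OF s2] _ c(1)]) auto
      moreover have "consistent I (Suc (Suc k)) (read_state I s2)"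
        using slot_consistent[OF v c(2) conjunct2[OF s2] t] .
      ultimately have "P (Suc k) s2" unfolding P_def by blast
      moreover have "s2 TV 0 = Suc k" using s2 tv unfolding same_except_def by simp
      ultimately show "s2 TV 0 = Suc k \<and> P (Suc k) s2" by blast
    qed
  next
    fix s' B' assume "P (horizon I) s'"
    then show "\<exists>st idle. greedy_run I st idle \<and> st (Suc (horizon I)) = read_state I s'"
      using v unfolding P_def greedy_run_def by blast
  qed (use x(3) in auto)
qed

section \<open>Preprocessing of the input\<close>

definition loaded :: "sched_instance \<Rightarrow> store \<Rightarrow> bool" where
  "loaded I s \<longleftrightarrow> s INP 0 = num_machines I \<and> s INP 1 = num_intervals I \<and>
     s INP 2 = interval_len I \<and> s INP 3 = num_jobs I \<and>
     (\<forall>j\<in>jobs I. s INP (4 + (j - 1) * 3) = job_len I j) \<and>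
     (\<forall>j\<in>jobs I. \<forall>j'\<in>jobs I.
        s INP (4 + num_jobs I * 3 + ((j - 1) * num_jobs I + (j' - 1))) = of_bool (job_prec I j j')) \<and>
     (\<forall>i\<in>machines I. \<forall>t\<in>{1..horizon I}.
        s INP (4 + num_jobs I * 3 + num_jobs I * num_jobs I + ((i - 1) * horizon I + (t - 1))) =
        capacity I i t)"

text \<open>The product \<open>p * L\<close> by repeated addition; \<open>p\<close> rounds are
  affordable whenever \<open>p\<close> is bounded by the input size.\<close>

definition horizon_code :: com where
  "horizon_code = For IV (Cell INP (Const 1)) (set_var HOR (Add (var HOR) (Cell INP (Const 2))))"

definition jobs_code :: com where
  "jobs_code = Seq (set_var PTR (Const 4)) (For JV job_count
     (Seq (Assign LEN (var JV) (Cell INP (var PTR)))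
     (Seq (Assign OFF (var JV) (var ACC))
     (Seq (set_var ACC (Add (var ACC) (Add (Cell INP (var PTR)) (Cell INP (var PTR)))))
     (Seq (Assign REM (var JV) (Add (Cell INP (var PTR)) (Const 1)))
          (set_var PTR (Add (var PTR) (Const 3))))))))"

text \<open>The stored address is one less than the start of the row because columns are numbered
  from 1.\<close>

definition prec_code :: com where
  "prec_code = For JV job_count
     (Seq (Assign PRB (var JV) (Sub (var PTR) (Const 1))) (set_var PTR (Add (var PTR) job_count)))"

definition cap_code :: com where
  "cap_code = For IV machine_count
     (Seq (Assign CPB (var IV) (Sub (var PTR) (Const 1))) (set_var PTR (Add (var PTR) (var HOR))))"

definition setup_code :: com where
  "setup_code = Seq horizon_code (Seq jobs_code (Seq prec_code cap_code))"

section \<open>Verification of the preprocessing\<close>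

lemma horizon_code_runs:
  assumes "loaded I s" "s HOR 0 = 0" "num_intervals I * 40 + 20 \<le> b"
    and Q: "\<And>s' b'. same_except {HOR, IV} s s' \<Longrightarrow> s' HOR 0 = horizon I \<Longrightarrow>
      b - (num_intervals I * 40 + 20) \<le> b' \<Longrightarrow> Q s' b'"
  shows "runs horizon_code s b Q"
proof -
  define P where "P k s' \<longleftrightarrow> same_except {HOR, IV} s s' \<and> s' HOR 0 = k * interval_len I" for k s'
  have inp: "s' INP = s INP" if "P k s'" for k s' using that unfolding P_def same_except_def by auto
  show ?thesis unfolding horizon_code_def
  proof (rule For_runs[where P = P and n = "num_intervals I" and b = 28])
    show "P 0 s" using assms(2) unfolding P_def by simp
    show "aval (Cell INP (Const 1)) s' = num_intervals I" if "P k s'" for k s'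
      using inp[OF that] assms(1) unfolding loaded_def by simp
    show "P k (s'(IV := (s' IV)(0 := v)))" if "P k s'" for k s' v
      using that unfolding P_def by (auto intro: same_except_upd)
    show "runs (set_var HOR (Add (var HOR) (Cell INP (Const 2)))) s1 28
        (\<lambda>s' _. s' IV 0 = Suc k \<and> P (Suc k) s')" if "P k s1" "s1 IV 0 = Suc k" for k s1
      using that inp[OF that(1)] assms(1) unfolding P_def loaded_def
      by (auto intro: same_except_upd)
    show "Q s' B'" if "P (num_intervals I) s'" "b - (num_intervals I * (28 + 12) + 9) \<le> B'" for s' B'
      using that Q[of s' B'] unfolding P_def horizon_def by auto
  qed (use assms(3) in auto)
qed

lemma jobs_code_runs:
  assumes "loaded I s" "s ACC 0 = 0" "num_jobs I * 80 + 20 \<le> b"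
    and Q: "\<And>s' b'. same_except {LEN, OFF, ACC, REM, PTR, JV} s s' \<Longrightarrow>
      s' PTR 0 = 4 + num_jobs I * 3 \<Longrightarrow>
      (\<forall>j\<in>jobs I. s' LEN j = job_len I j \<and> s' OFF j = 2 * (\<Sum>x\<in>{1..<j}. job_len I x) \<and>
         s' REM j = job_len I j + 1) \<Longrightarrow>
      b - (num_jobs I * 80 + 20) \<le> b' \<Longrightarrow> Q s' b'"
  shows "runs jobs_code s b Q"
proof -
  define P where "P k s' \<longleftrightarrow> same_except {LEN, OFF, ACC, REM, PTR, JV} s s' \<and>
    s' PTR 0 = 4 + k * 3 \<and> s' ACC 0 = 2 * (\<Sum>x\<in>{1..<Suc k}. job_len I x) \<and>
    (\<forall>j\<in>{1..k}. s' LEN j = job_len I j \<and> s' OFF j = 2 * (\<Sum>x\<in>{1..<j}. job_len I x) \<and>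
         s' REM j = job_len I j + 1)" for k s'
  have inp: "s' INP = s INP" if "P k s'" for k s' using that unfolding P_def same_except_def by auto
  let ?s = "s(PTR := (s PTR)(0 := 4))"
  let ?c = "Seq (Assign LEN (var JV) (Cell INP (var PTR)))
     (Seq (Assign OFF (var JV) (var ACC))
     (Seq (set_var ACC (Add (var ACC) (Add (Cell INP (var PTR)) (Cell INP (var PTR)))))
     (Seq (Assign REM (var JV) (Add (Cell INP (var PTR)) (Const 1)))
          (set_var PTR (Add (var PTR) (Const 3))))))"
  have "runs (For JV job_count ?c) ?s (b - 3) Q"
  proof (rule For_runs[where P = P and n = "num_jobs I" and b = 68])
    show "P 0 ?s" using assms(2) unfolding P_def by (auto intro: same_except_upd)
    show "aval job_count s' = num_jobs I" if "P k s'" for k s'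
      using inp[OF that] assms(1) unfolding loaded_def by simp
    show "P k (s'(JV := (s' JV)(0 := v)))" if "P k s'" for k s' v
      using that unfolding P_def by (auto intro: same_except_upd)
    show "runs ?c s1 68 (\<lambda>s' _. s' JV 0 = Suc k \<and> P (Suc k) s')"
      if k: "k < num_jobs I" and P: "P k s1" and v: "s1 JV 0 = Suc k" for k s1
    proof -
      have "Suc k \<in> jobs I" using k unfolding jobs_def by simp
      then have "s INP (4 + (Suc k - 1) * 3) = job_len I (Suc k)"
        using assms(1) unfolding loaded_def by blast
      then have "s1 INP (4 + k * 3) = job_len I (Suc k)" using inp[OF P] by simp
      then show ?thesis using P v unfolding P_def
        by (auto intro!: same_except_upd simp: atLeastAtMostSuc_conv)
    qed
    show "Q s' B'" if "P (num_jobs I) s'" "b - 3 - (num_jobs I * (68 + 12) + 9) \<le> B'" for s' B'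
      using that Q[of s' B'] unfolding P_def jobs_def by auto
  qed (use assms(3) in auto)
  then show ?thesis using assms(3) unfolding jobs_code_def by (simp add: numeral_3_eq_3)
qed

lemma prec_code_runs:
  assumes "loaded I s" "s PTR 0 = a" "num_jobs I * 40 + 20 \<le> b"
    and Q: "\<And>s' b'. same_except {PRB, PTR, JV} s s' \<Longrightarrow>
      s' PTR 0 = a + num_jobs I * num_jobs I \<Longrightarrow>
      (\<forall>j\<in>jobs I. s' PRB j = a + (j - 1) * num_jobs I - 1) \<Longrightarrow>
      b - (num_jobs I * 40 + 20) \<le> b' \<Longrightarrow> Q s' b'"
  shows "runs prec_code s b Q"
proof -
  define P where "P k s' \<longleftrightarrow> same_except {PRB, PTR, JV} s s' \<and>
    s' PTR 0 = a + k * num_jobs I \<and>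
    (\<forall>j\<in>{1..k}. s' PRB j = a + (j - 1) * num_jobs I - 1)" for k s'
  have inp: "s' INP = s INP" if "P k s'" for k s' using that unfolding P_def same_except_def by auto
  have n: "s INP 3 = num_jobs I" using assms(1) unfolding loaded_def by simp
  show ?thesis unfolding prec_code_def
  proof (rule For_runs[where P = P and n = "num_jobs I" and b = 28])
    show "P 0 s" using assms(2) unfolding P_def by simp
    show "aval job_count s' = num_jobs I" if "P k s'" for k s'
      using inp[OF that] n by simp
    show "P k (s'(JV := (s' JV)(0 := v)))" if "P k s'" for k s' v
      using that unfolding P_def by (auto intro: same_except_upd)
    show "runs (Seq (Assign PRB (var JV) (Sub (var PTR) (Const 1)))
        (set_var PTR (Add (var PTR) job_count))) s1 28 (\<lambda>s' _. s' JV 0 = Suc k \<and> P (Suc k) s')"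
      if P: "P k s1" and v: "s1 JV 0 = Suc k" for k s1
      using P v inp[OF P] n unfolding P_def
      by (auto intro!: same_except_upd simp: atLeastAtMostSuc_conv)
    show "Q s' B'" if "P (num_jobs I) s'" "b - (num_jobs I * (28 + 12) + 9) \<le> B'" for s' B'
      using that Q[of s' B'] unfolding P_def jobs_def by auto
  qed (use assms(3) in auto)
qed

lemma cap_code_runs:
  assumes "loaded I s" "s PTR 0 = a" "s HOR 0 = horizon I" "num_machines I * 40 + 20 \<le> b"
    and Q: "\<And>s' b'. same_except {CPB, PTR, IV} s s' \<Longrightarrow>
      (\<forall>i\<in>machines I. s' CPB i = a + (i - 1) * horizon I - 1) \<Longrightarrow> Q s' b'"
  shows "runs cap_code s b Q"
proof -
  define P where "P k s' \<longleftrightarrow> same_except {CPB, PTR, IV} s s' \<and>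
    s' PTR 0 = a + k * horizon I \<and>
    (\<forall>i\<in>{1..k}. s' CPB i = a + (i - 1) * horizon I - 1)" for k s'
  have inp: "s' INP = s INP" "s' HOR 0 = horizon I" if "P k s'" for k s'
    using that assms(3) unfolding P_def same_except_def by auto
  have n: "s INP 0 = num_machines I" using assms(1) unfolding loaded_def by simp
  show ?thesis unfolding cap_code_def
  proof (rule For_runs[where P = P and n = "num_machines I" and b = 28])
    show "P 0 s" using assms(2) unfolding P_def by simp
    show "aval machine_count s' = num_machines I" if "P k s'" for k s'
      using inp[OF that] n by simp
    show "P k (s'(IV := (s' IV)(0 := v)))" if "P k s'" for k s' v
      using that unfolding P_def by (auto intro: same_except_upd)
    show "runs (Seq (Assign CPB (var IV) (Sub (var PTR) (Const 1)))
        (set_var PTR (Add (var PTR) (var HOR)))) s1 28 (\<lambda>s' _. s' IV 0 = Suc k \<and> P (Suc k) s')"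
      if P: "P k s1" and v: "s1 IV 0 = Suc k" for k s1
      using P v inp[OF P] unfolding P_def
      by (auto intro!: same_except_upd simp: atLeastAtMostSuc_conv)
    show "Q s' B'" if "P (num_machines I) s'" for s' B'
      using that Q[of s' B'] unfolding P_def machines_def by auto
  qed (use assms(4) in auto)
qed

definition setup_cost :: "'a::comm_semiring_1 \<Rightarrow> 'a" where
  "setup_cost x = (x * 40 + 20) + (x * 80 + 20) + (x * 40 + 20) + (x * 40 + 20)"

lemma loaded_cong: "s' INP = s INP \<Longrightarrow> loaded I s' = loaded I s"
  unfolding loaded_def by simp

text \<open>\<open>MAC\<close>, \<open>OWN\<close> and \<open>OUT\<close> are never initialised: by
  \<open>z\<close> they are zero, which already means that no job is started, all machines are
  vacant and no task is placed.\<close>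

lemma setup_code_runs:
  assumes ld: "loaded I s" and z: "\<And>x. x \<noteq> 0 \<Longrightarrow> s x = (\<lambda>_. 0)"
    and x: "num_intervals I \<le> x" "num_machines I \<le> x" "num_jobs I \<le> x"
  shows "runs setup_code s (setup_cost x) (\<lambda>s' _. static I s' \<and> initial I (read_state I s'))"
proof -
  let ?R = "\<lambda>s'. static I s' \<and> initial I (read_state I s')"
  have b: "num_intervals I * 40 \<le> x * 40" "num_machines I * 40 \<le> x * 40"
    "num_jobs I * 40 \<le> x * 40" "num_jobs I * 80 \<le> x * 80" using x by auto
  show ?thesis unfolding setup_code_def runs_Seq
  proof (rule horizon_code_runs[OF ld])
    fix s1 b1 assume s1: "same_except {HOR, IV} s s1" "s1 HOR 0 = horizon I"
      and b1: "setup_cost x - (num_intervals I * 40 + 20) \<le> b1"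
    have b1': "(x * 80 + 20) + (x * 40 + 20) + (x * 40 + 20) \<le> b1"
      using b b1 unfolding setup_cost_def by linarith
    have ld1: "loaded I s1" using ld s1(1) by (subst loaded_cong[of _ s]) (auto simp: same_except_def)
    show "runs jobs_code s1 b1 (\<lambda>s' b'. runs prec_code s' b' (\<lambda>s' b'. runs cap_code s' b' (\<lambda>s' _. ?R s')))"
    proof (rule jobs_code_runs[OF ld1])
      show "s1 ACC 0 = 0" using s1(1) z unfolding same_except_def by simp
      fix s2 b2 assume s2: "same_except {LEN, OFF, ACC, REM, PTR, JV} s1 s2"
        "s2 PTR 0 = 4 + num_jobs I * 3"
        "\<forall>j\<in>jobs I. s2 LEN j = job_len I j \<and> s2 OFF j = 2 * (\<Sum>x\<in>{1..<j}. job_len I x) \<and>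
           s2 REM j = job_len I j + 1"
        and b2: "b1 - (num_jobs I * 80 + 20) \<le> b2"
      have b2': "(x * 40 + 20) + (x * 40 + 20) \<le> b2" using b b1' b2 by linarith
      have ld2: "loaded I s2" using ld1 s2(1) by (subst loaded_cong[of _ s1]) (auto simp: same_except_def)
      show "runs prec_code s2 b2 (\<lambda>s' b'. runs cap_code s' b' (\<lambda>s' _. ?R s'))"
      proof (rule prec_code_runs[OF ld2 s2(2)])
        fix s3 b3 assume s3: "same_except {PRB, PTR, JV} s2 s3"
          "s3 PTR 0 = 4 + num_jobs I * 3 + num_jobs I * num_jobs I"
          "\<forall>j\<in>jobs I. s3 PRB j = 4 + num_jobs I * 3 + (j - 1) * num_jobs I - 1"
          and b3: "b2 - (num_jobs I * 40 + 20) \<le> b3"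
        have ld3: "loaded I s3" using ld2 s3(1) by (subst loaded_cong[of _ s2]) (auto simp: same_except_def)
        show "runs cap_code s3 b3 (\<lambda>s' _. ?R s')"
        proof (rule cap_code_runs[OF ld3 s3(2)])
          show "s3 HOR 0 = horizon I" using s1 s2 s3 unfolding same_except_def by simp
          show "num_machines I * 40 + 20 \<le> b3" using b b2' b3 by linarith
          fix s4 :: store assume s4: "same_except {CPB, PTR, IV} s3 s4"
            "\<forall>i\<in>machines I. s4 CPB i =
              4 + num_jobs I * 3 + num_jobs I * num_jobs I + (i - 1) * horizon I - 1"
          have e: "s4 INP = s3 INP" "s4 HOR = s1 HOR" "s4 LEN = s2 LEN" "s4 OFF = s2 OFF"
            "s4 PRB = s3 PRB" "s4 REM = s2 REM" "s4 MAC = s MAC" "s4 OWN = s OWN" "s4 OUT = s OUT"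
            using s1(1) s2(1) s3(1) s4(1) unfolding same_except_def by auto
          have ld4: "loaded I s4" using ld3 e(1) loaded_cong by blast
          have "s4 INP (s4 PRB j + j') = of_bool (job_prec I j j')"
            if "j \<in> jobs I" "j' \<in> jobs I" for j j'
          proof -
            have "s4 PRB j + j' = 4 + num_jobs I * 3 + ((j - 1) * num_jobs I + (j' - 1))"
              using s3(3) e that unfolding jobs_def by auto
            then show ?thesis using ld4 that unfolding loaded_def by metis
          qed
          moreover have "s4 INP (s4 CPB i + t) = capacity I i t"
            if "i \<in> machines I" "t \<in> {1..horizon I}" for i t
          proof -
            have "s4 CPB i + t =
                4 + num_jobs I * 3 + num_jobs I * num_jobs I + ((i - 1) * horizon I + (t - 1))"
              using s4(2) that by auto
            then show ?thesis using ld4 that unfolding loaded_def by metis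
          qed
          ultimately have "static I s4"
            using ld4 e s1(2) s2(3) unfolding static_def loaded_def by auto
          moreover have "initial I (read_state I s4)"
            using e s2(3) z unfolding initial_def by (auto simp: placement_def)
          ultimately show "?R s4" by blast
        qed
      qed (use b b2' in linarith)
    qed (use b b1' in linarith)
  qed (use z b in \<open>auto simp: setup_cost_def\<close>)
qed

section \<open>Input and output encoding\<close>

lemma length_concat_blocks:
  assumes "\<And>j. j \<in> {1..n} \<Longrightarrow> length (f j) = c"
  shows "length (concat (map f [1..<n + 1])) = n * c"
  using assms by (induction n) auto

lemma block_index_less:
  assumes "j \<in> {1..n}" "r < c"
  shows "(j - 1) * c + r < n * (c :: nat)"
proof -
  have "(j - 1) * c + r < Suc (j - 1) * c" using assms by (cases j) auto
  also have "\<dots> \<le> n * c" using assms by (intro mult_le_mono) auto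
  finally show ?thesis .
qed

lemma nth_concat_blocks:
  assumes "\<And>j. j \<in> {1..n} \<Longrightarrow> length (f j) = c" and "j \<in> {1..n}" "r < c"
  shows "concat (map f [1..<n + 1]) ! ((j - 1) * c + r) = f j ! r"
  using assms
proof (induction n)
  case (Suc n)
  have l: "length (concat (map f [1..<n + 1])) = n * c"
    by (rule length_concat_blocks) (use Suc.prems in auto)
  have split: "concat (map f [1..<Suc n + 1]) = concat (map f [1..<n + 1]) @ f (Suc n)"
    by simp
  show ?case
  proof (cases "j = Suc n")
    case True
    then show ?thesis unfolding split nth_append l by simp
  next
    case False
    then have j: "j \<in> {1..n}" using Suc.prems by auto
    then have "(j - 1) * c + r < n * c" using Suc.prems by (intro block_index_less)
    then show ?thesis unfolding split nth_append l using Suc.IH j Suc.prems by auto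
  qed
qed simp

lemma length_encode_instance:
  "length (encode_instance I) =
     4 + num_jobs I * 3 + num_jobs I * num_jobs I + num_machines I * horizon I"
  unfolding encode_instance_def
  by (simp add: length_concat_blocks[where c = 3, simplified]
      length_concat_blocks[where c = "num_jobs I", simplified]
      length_concat_blocks[where c = "horizon I", simplified])

lemma loaded_init_store: "loaded I (init_store (encode_instance I))"
proof -
  define n where "n = num_jobs I"
  define A where "A = [num_machines I, num_intervals I, interval_len I, n]"
  define B where "B = concat (map (\<lambda>j. [job_len I j, release I j, deadline I j]) [1..<n + 1])"
  define C :: "nat list" where
    "C = concat (map (\<lambda>j. map (\<lambda>j'. of_bool (job_prec I j j')) [1..<n + 1]) [1..<n + 1])"
  define E where "E = concat (map (\<lambda>i. map (capacity I i) [1..<horizon I + 1]) [1..<num_machines I + 1])"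
  have e: "encode_instance I = A @ B @ C @ E"
    unfolding encode_instance_def A_def B_def C_def E_def n_def by simp
  have l: "length A = 4" "length B = n * 3" "length C = n * n" "length E = num_machines I * horizon I"
    unfolding A_def B_def C_def E_def by (simp, (rule length_concat_blocks, simp)+)
  have s: "init_store (encode_instance I) 0 i = encode_instance I ! i"
    if "i < 4 + n * 3 + n * n + num_machines I * horizon I" for i
    using that unfolding init_store_def e by (simp add: l)
  have "encode_instance I ! i = A ! i" if "i < 4" for i
    using that unfolding e nth_append l by simp
  then have a: "init_store (encode_instance I) 0 i = A ! i" if "i < 4" for i using that s by simp
  have "init_store (encode_instance I) 0 (4 + (j - 1) * 3) = job_len I j" if "j \<in> {1..n}" for j
  proof -
    have i: "(j - 1) * 3 + 0 < n * 3" using block_index_less[OF that, of 0 3] by simp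
    then have "init_store (encode_instance I) 0 (4 + (j - 1) * 3) = B ! ((j - 1) * 3 + 0)"
      by (subst s) (auto simp: e nth_append l)
    also have "\<dots> = job_len I j"
      unfolding B_def by (subst nth_concat_blocks[where c = 3]) (use that in auto)
    finally show ?thesis .
  qed
  moreover have "init_store (encode_instance I) 0 (4 + n * 3 + ((j - 1) * n + (j' - 1))) =
      of_bool (job_prec I j j')" if "j \<in> {1..n}" "j' \<in> {1..n}" for j j'
  proof -
    have j': "j' - 1 < n" using that by auto
    have i: "(j - 1) * n + (j' - 1) < n * n" using block_index_less[OF that(1) j'] .
    then have "init_store (encode_instance I) 0 (4 + n * 3 + ((j - 1) * n + (j' - 1))) =
        C ! ((j - 1) * n + (j' - 1))"
      by (subst s) (auto simp: e nth_append l)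
    also have "\<dots> = of_bool (job_prec I j j')"
      unfolding C_def by (subst nth_concat_blocks[where c = n]) (use that j' in \<open>auto simp del: upt_Suc\<close>)
    finally show ?thesis .
  qed
  moreover have "init_store (encode_instance I) 0
      (4 + n * 3 + n * n + ((i - 1) * horizon I + (t - 1))) = capacity I i t"
    if "i \<in> {1..num_machines I}" "t \<in> {1..horizon I}" for i t
  proof -
    have t': "t - 1 < horizon I" using that by auto
    have i: "(i - 1) * horizon I + (t - 1) < num_machines I * horizon I"
      using block_index_less[OF that(1) t'] .
    then have "init_store (encode_instance I) 0
        (4 + n * 3 + n * n + ((i - 1) * horizon I + (t - 1))) = E ! ((i - 1) * horizon I + (t - 1))"
      by (subst s) (auto simp: e nth_append l)
    also have "\<dots> = capacity I i t"
      unfolding E_def by (subst nth_concat_blocks[where c = "horizon I"])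
        (use that t' in \<open>auto simp del: upt_Suc\<close>)
    finally show ?thesis .
  qed
  ultimately show ?thesis
    unfolding loaded_def jobs_def machines_def n_def[symmetric] using a[of 0] a[of 1] a[of 2] a[of 3]
    by (auto simp: A_def eval_nat_numeral)
qed

text \<open>Each number contributes at least its delimiter.\<close>

lemma length_le_input_size: "length xs \<le> input_size xs"
  unfolding input_size_def by (induction xs) auto

lemma concat_pairs:
  assumes "\<And>k. k \<in> {1..l} \<Longrightarrow> f k = [g (b + 2 * (k - 1)), g (b + 2 * (k - 1) + 1)]"
  shows "concat (map f [1..<l + 1]) = map (\<lambda>i. g (b + i)) [0..<2 * l]"
  using assms
proof (induction l)
  case (Suc l)
  then have "concat (map f [1..<l + 1]) = map (\<lambda>i. g (b + i)) [0..<2 * l]" by simp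
  then show ?case using Suc.prems[of "Suc l"] by simp
qed simp

text \<open>A discarded task has the value \<open>(0, 0)\<close>, which is also its code, so in both
  cases the encoding just copies two adjacent cells of \<open>OUT\<close>, and the blocks follow
  each other without gaps.\<close>

lemma encode_schedule_eq:
  assumes S: "\<And>j k. j \<in> jobs I \<Longrightarrow> k \<in> {1..job_len I j} \<Longrightarrow> S (j, k) = placement I s (j, k)"
    and D: "\<And>a. a \<in> tasks I \<Longrightarrow> a \<in> D \<longleftrightarrow> S a = (0, 0)"
  shows "encode_schedule I D S = map (s OUT) [0..<2 * (\<Sum>x\<in>{1..<num_jobs I + 1}. job_len I x)]"
proof -
  define h where "h a = (if a \<in> D then [0, 0] else [fst (S a), snd (S a)])" for a
  have h: "h (j, k) = [s OUT (2 * (\<Sum>x\<in>{1..<j}. job_len I x) + 2 * (k - 1)),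
      s OUT (2 * (\<Sum>x\<in>{1..<j}. job_len I x) + 2 * (k - 1) + 1)]"
    if "j \<in> jobs I" "k \<in> {1..job_len I j}" for j k
  proof -
    have "(j, k) \<in> tasks I" using that unfolding tasks_def tasks_of_def by auto
    then have "h (j, k) = [fst (S (j, k)), snd (S (j, k))]" using D unfolding h_def by auto
    then show ?thesis using S[OF that]
      unfolding placement_def task_pos_def by (simp add: algebra_simps)
  qed
  have "concat (map (\<lambda>j. concat (map (\<lambda>k. h (j, k)) [1..<job_len I j + 1])) [1..<n + 1]) =
      map (s OUT) [0..<2 * (\<Sum>x\<in>{1..<n + 1}. job_len I x)]" if "n \<le> num_jobs I" for n
    using that
  proof (induction n)
    case (Suc n)
    have j: "Suc n \<in> jobs I" using Suc.prems unfolding jobs_def by auto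
    define a where "a = 2 * (\<Sum>x\<in>{1..<Suc n}. job_len I x)"
    have "concat (map (\<lambda>k. h (Suc n, k)) [1..<job_len I (Suc n) + 1]) =
        map (\<lambda>i. s OUT (a + i)) [0..<2 * job_len I (Suc n)]"
      unfolding a_def by (rule concat_pairs) (use h[OF j] in auto)
    moreover have "concat (map (\<lambda>j. concat (map (\<lambda>k. h (j, k)) [1..<job_len I j + 1])) [1..<n + 1]) =
        map (s OUT) [0..<a]"
      using Suc unfolding a_def by simp
    moreover have "map (s OUT) [0..<a + b] = map (s OUT) [0..<a] @ map (\<lambda>i. s OUT (a + i)) [0..<b]"
      for b by (rule nth_equalityI) (auto simp: nth_append)
    moreover have "2 * (\<Sum>x\<in>{1..<Suc n + 1}. job_len I x) = a + 2 * job_len I (Suc n)"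
      unfolding a_def by simp
    moreover have "[1..<Suc n + 1] = [1..<n + 1] @ [Suc n]" by simp
    ultimately show ?case by (simp only: map_append concat_append) simp
  qed simp
  note blocks = this[of "num_jobs I", OF order_refl]
  have "concat (map h (concat xss)) = concat (map (\<lambda>xs. concat (map h xs)) xss)" for xss
    by (induction xss) auto
  then have "encode_schedule I D S =
      concat (map (\<lambda>j. concat (map (\<lambda>k. h (j, k)) [1..<job_len I j + 1])) [1..<num_jobs I + 1])"
    unfolding encode_schedule_def task_list_def h_def[symmetric]
    by (simp del: upt_Suc add: comp_def)
  with blocks show ?thesis by simp
qed

section \<open>The algorithm\<close>

text \<open>Without jobs nothing may be computed: \<open>num_intervals\<close> may then be exponential in the input size.\<close>

definition greedy_code :: com where
  "greedy_code = Cond (Less (Const 0) job_count) (Seq setup_code sweep_code) Skip"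

text \<open>The 5 covers the guard, of cost 4, and \<open>Skip\<close> in the case without
  jobs.\<close>

definition greedy_cost :: "'a::comm_semiring_1 \<Rightarrow> 'a" where
  "greedy_cost x = 5 + setup_cost x + (x * (slot_cost x + 12) + 9)"

lemma poly_greedy_cost: "poly (greedy_cost [:0, 1:]) x = greedy_cost (x :: nat)"
  unfolding greedy_cost_def setup_cost_def slot_cost_def by simp

text \<open>With a job present, \<open>S'\<close> places the task \<open>(1, 1)\<close>, so there is
  a machine and a slot. The capacity table of \<open>m * T\<close> entries then makes the input at
  least as long as \<open>m\<close>, \<open>T\<close> and, because intervals are nonempty,
  \<open>p\<close>.\<close>

lemma greedy_code_runs:
  assumes v: "valid_instance I" and S': "relaxed_assignment I S'" and n: "num_jobs I \<noteq> 0"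
  shows "runs greedy_code (init_store (encode_instance I))
    (greedy_cost (input_size (encode_instance I)))
    (\<lambda>s _. \<exists>st idle. greedy_run I st idle \<and> st (Suc (horizon I)) = read_state I s)"
proof -
  let ?s = "init_store (encode_instance I)" and ?x = "input_size (encode_instance I)"
  have "1 \<in> jobs I" using n unfolding jobs_def by simp
  moreover from this have "1 \<le> job_len I 1" using v unfolding valid_instance_def by blast
  ultimately have "(1, 1) \<in> tasks I" unfolding tasks_def tasks_of_def by force
  then have "S' (1, 1) \<in> available I" using S' unfolding relaxed_assignment_def by blast
  then have mT: "1 \<le> num_machines I" "1 \<le> horizon I" unfolding available_def by auto
  have len: "4 + num_jobs I * 3 + num_jobs I * num_jobs I + num_machines I * horizon I \<le> ?x"
    using length_le_input_size[of "encode_instance I"] length_encode_instance by simp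
  have "num_machines I \<le> num_machines I * horizon I" "horizon I \<le> num_machines I * horizon I"
    "num_intervals I \<le> horizon I"
    using mT v unfolding valid_instance_def horizon_def by auto
  then have x: "num_machines I \<le> ?x" "num_jobs I \<le> ?x" "horizon I \<le> ?x" "num_intervals I \<le> ?x"
    using len by linarith+
  have z: "?s y = (\<lambda>_. 0)" if "y \<noteq> 0" for y using that unfolding init_store_def by auto
  note ld = loaded_init_store[of I]
  have "runs setup_code ?s (setup_cost ?x + (?x * (slot_cost ?x + 12) + 9))
    (\<lambda>s' b'. (static I s' \<and> initial I (read_state I s')) \<and> ?x * (slot_cost ?x + 12) + 9 \<le> b')"
    using setup_code_runs[OF ld z x(4,1,2)] unfolding runs_def by fastforce
  then have "runs (Seq setup_code sweep_code) ?s (setup_cost ?x + (?x * (slot_cost ?x + 12) + 9))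
    (\<lambda>s _. \<exists>st idle. greedy_run I st idle \<and> st (Suc (horizon I)) = read_state I s)"
    by (rule runs_SeqI) (use sweep_code_runs[OF v _ _ x(1-3)] in blast)
  then show ?thesis using n ld unfolding greedy_code_def greedy_cost_def loaded_def
    by (subst runs_Cond) (auto elim!: runs_mono simp del: runs_Seq)
qed

theorem theorem5:
  "\<exists>(prog :: com) (P :: nat poly). \<forall>I :: sched_instance.
     valid_instance I \<longrightarrow> (\<exists>S'. relaxed_assignment I S') \<longrightarrow>
     (\<exists>(t :: nat) (s :: store) (D :: (nat \<times> nat) set) (S :: nat \<times> nat \<Rightarrow> nat \<times> nat).
        exec prog (init_store (encode_instance I)) t s \<and>
        t \<le> poly P (input_size (encode_instance I)) \<and>
        has_output s (encode_schedule I D S) \<and>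
        D \<subseteq> tasks I \<and>
        (\<forall>a \<in> tasks I - D. S a \<in> available I) \<and>
        inj_on S (tasks I - D) \<and>
        (\<forall>j \<in> jobs I. \<forall>a \<in> tasks_of I j - D. \<forall>a' \<in> tasks_of I j - D. fst (S a) = fst (S a')) \<and>
        (\<forall>a \<in> tasks I - D. \<forall>a' \<in> tasks I - D.
           task_prec I a a' \<longrightarrow> snd (S a) < snd (S a')) \<and>
        (\<forall>j \<in> jobs I. \<forall>j' \<in> jobs I.
           job_prec I j j' \<and> (j, job_len I j) \<notin> D \<and> (j', 1) \<notin> D \<and>
           fst (S (j, job_len I j)) \<noteq> fst (S (j', 1)) \<longrightarrow>
           snd (S (j', 1)) > snd (S (j, job_len I j)) + 1) \<and>
        card D \<le> 6 * (num_intervals I)\<^sup>2 * num_machines I * Delta I)"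
proof (rule exI[of _ greedy_code], rule exI[of _ "greedy_cost [:0, 1:]"], intro allI impI)
  fix I assume v: "valid_instance I" and "\<exists>S'. relaxed_assignment I S'"
  then obtain S' where S': "relaxed_assignment I S'" by blast
  let ?s = "init_store (encode_instance I)" and ?x = "input_size (encode_instance I)"
  show "\<exists>t s D S. exec greedy_code ?s t s \<and> t \<le> poly (greedy_cost [:0, 1:]) ?x \<and>
        has_output s (encode_schedule I D S) \<and>
        D \<subseteq> tasks I \<and>
        (\<forall>a \<in> tasks I - D. S a \<in> available I) \<and>
        inj_on S (tasks I - D) \<and>
        (\<forall>j \<in> jobs I. \<forall>a \<in> tasks_of I j - D. \<forall>a' \<in> tasks_of I j - D. fst (S a) = fst (S a')) \<and>
        (\<forall>a \<in> tasks I - D. \<forall>a' \<in> tasks I - D.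
           task_prec I a a' \<longrightarrow> snd (S a) < snd (S a')) \<and>
        (\<forall>j \<in> jobs I. \<forall>j' \<in> jobs I.
           job_prec I j j' \<and> (j, job_len I j) \<notin> D \<and> (j', 1) \<notin> D \<and>
           fst (S (j, job_len I j)) \<noteq> fst (S (j', 1)) \<longrightarrow>
           snd (S (j', 1)) > snd (S (j, job_len I j)) + 1) \<and>
        card D \<le> 6 * (num_intervals I)\<^sup>2 * num_machines I * Delta I"
  proof (cases "num_jobs I = 0")
    case True
    have "runs greedy_code ?s (greedy_cost ?x) (\<lambda>_ _. True)"
      using loaded_init_store[of I] True
      unfolding greedy_code_def greedy_cost_def setup_cost_def loaded_def by simp
    then obtain t s where "exec greedy_code ?s t s" "t \<le> poly (greedy_cost [:0, 1:]) ?x"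
      unfolding runs_def poly_greedy_cost by blast
    moreover have "encode_schedule I {} (\<lambda>_. (0, 0)) = []" "jobs I = {}" "tasks I = {}"
      using True unfolding encode_schedule_def task_list_def jobs_def tasks_def by auto
    ultimately show ?thesis
      by (intro exI[of _ t] exI[of _ s] exI[of _ "{}"] exI[of _ "\<lambda>_. (0, 0)"])
        (simp add: has_output_def)
  next
    case False
    then obtain t s st idle where e: "exec greedy_code ?s t s" "t \<le> poly (greedy_cost [:0, 1:]) ?x"
      and g: "greedy_run I st idle" and s: "st (Suc (horizon I)) = read_state I s"
      using greedy_code_runs[OF v S'] unfolding runs_def poly_greedy_cost by blast
    interpret greedy_run I st idle by (rule g)
    have f: "final = placement I s" unfolding final_def s by simp
    have "encode_schedule I discarded final =
        map (s OUT) [0..<2 * (\<Sum>x\<in>{1..<num_jobs I + 1}. job_len I x)]"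
      by (rule encode_schedule_eq) (auto simp: f discarded_def)
    then have out: "has_output s (encode_schedule I discarded final)"
      unfolding has_output_def by simp
    \<comment> \<open>The release slot of a job lies in some interval, so \<open>p \<ge> 1\<close>
      and \<open>6 * p^2\<close> is at least 2.\<close>
    have "1 \<in> jobs I" using False unfolding jobs_def by simp
    then have "num_intervals I \<noteq> 0" using v unfolding valid_instance_def by fastforce
    then have "1 \<le> (num_intervals I)\<^sup>2" by simp
    then have "2 * num_machines I * Delta I \<le> 6 * (num_intervals I)\<^sup>2 * num_machines I * Delta I"
      by (intro mult_le_mono order_refl) simp
    then have c: "card discarded \<le> 6 * (num_intervals I)\<^sup>2 * num_machines I * Delta I"
      using card_discarded[OF S'] by linarith
    have "discarded \<subseteq> tasks I" unfolding discarded_def by blast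
    then show ?thesis
      using e out c final_schedule
      by (intro exI[of _ t] exI[of _ s] exI[of _ discarded] exI[of _ final] conjI) blast+
  qed
qed

end
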